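(* Let $0\le t<1$ and $N\ge1$. For $\lambda,\mu,\nu\in\mathrm{Sig}_N$ with $\lambda\prec\mu$, $\lambda\prec\nu$, let $\tilde\rho\in\mathrm{Sig}_N$ be the random output of the Hall-Littlewood RSK algorithm with input $(\lambda,\mu,\nu)$, i.e. $\tilde\rho$ takes the value $\rho$ with probability $U(\mu\to\rho\mid\lambda\to\nu)$ (defined in the context). Then for any $k\in\mathbb Z$ the probability distribution of the family $\{\tilde\rho'_a\}_{a\le k}$ is determined by the families $\{\lambda'_a\}_{a\le k}$, $\{\mu'_a\}_{a\le k}$, $\{\nu'_a\}_{a\le k}$ only. Here, for a signature $\kappa$ and $a\in\mathbb Z$, $\kappa'_a$ denotes the number of coordinates of $\kappa$ that are $\ge a$.
   Context: A signature of length $N$ is a sequence of integers $\lambda_1\ge\dots\ge\lambda_N$; $\mathrm{Sig}_N$ is the set of these and $|\lambda|=\lambda_1+\dots+\lambda_N$. For $\lambda,\mu\in\mathrm{Sig}_N$ write $\lambda\prec\mu$ if $\mu_1\ge\lambda_1\ge\mu_2\ge\lambda_2\ge\dots\ge\mu_N\ge\lambda_N$. A signature $\kappa$ is viewed as $N$ particles on $\mathbb Z$ at positions $\kappa_1,\dots,\kappa_N$; moving a particle at position $k$ by $+1$ means replacing one coordinate equal to $k$ by $k+1$ (and reordering). Definition of $U(\mu\to\rho\mid\lambda\to\nu)$. It is $0$ unless $\lambda\prec\mu\prec\rho$, $\lambda\prec\nu\prec\rho$ and $|\nu|-|\lambda|=|\rho|-|\mu|$. Otherwise put $m=|\nu|-|\lambda|$,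 $n=|\mu|-|\lambda|$, and consider functions $\Lambda:\{0,\dots,m\}\times\{0,\dots,n\}\to\mathrm{Sig}_N$ with $\Lambda(0,0)=\lambda$, $\Lambda(m,0)=\nu$, $\Lambda(0,n)=\mu$, $\Lambda(m,n)=\rho$ such that: $\Lambda(i+1,j)$ is obtained from $\Lambda(i,j)$ by moving one particle, at position denoted $h_{i,j}$, by $+1$; $\Lambda(i,j+1)$ is obtained from $\Lambda(i,j)$ by moving one particle, at position denoted $v_{i,j}$, by $+1$; $h_{i,j}<h_{i+1,j}$ and $v_{i,j}<v_{i,j+1}$ whenever defined; and whenever $h_{i,j}=v_{i,j}=k$ (with $0\le i<m$, $0\le j<n$), one has $h_{i,j+1}=v_{i+1,j}\in\{k,k+1\}$. Such $\Lambda$ is called admissible; at most one exists. If none exists, $U:=0$. If it exists, let $b_{i,j}$ ($0\le i<m$, $0\le j<n$) be the unit box with south-west corner $(i,j)$. It is a zero-box if $h_{i,j}=v_{i,j}=h_{i,j+1}=v_{i+1,j}$; a one-box if $h_{i,j}=v_{i,j}=h_{i,j+1}-1=v_{i+1,j}-1$; and otherwise trivial (then $h_{i,j}=h_{i,j+1}\ne v_{i,j}=v_{i+1,j}$). Boxes outside the rectangle are considered trivial, and $h_{-1,j}=v_{i,-1}=-\infty$. For a zero-box or one-box $B=b_{i,j}$ put $r(B)=h_{i,j}=v_{i,j}$, $\bar r(B)=h_{i,j+1}=v_{i+1,j}$, and $c(B)=t^{\#}$, where $\#$ is the number of coordinates of $\Lambda(i,j)$ equal to $r(B)$. The weight $w(B)$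 of $B=b_{i,j}$ is: (1) $w(B)=1$ if $B$ is trivial; or $B$ is a one-box and at least one of $b_{i-1,j},b_{i,j-1}$ is a one-box; or $B$ is a one-box and $b_{i-1,j-1}$ is a one-box with $\bar r(b_{i-1,j-1})=r(B)-1$; or $B$ is a zero-box and $b_{i-1,j-1}$ is a zero-box with $\bar r(b_{i-1,j-1})=r(B)-1$; (2) $w(B)=t$ if $B$ is a zero-box and exactly one of $h_{i-1,j},v_{i,j-1}$ equals $r(B)-1$; (3) $w(B)=1-t$ if $B$ is a one-box, $b_{i-1,j}$ and $b_{i,j-1}$ are trivial, and exactly one of $h_{i-1,j},v_{i,j-1}$ equals $r(B)-1$; (4) $w(B)=\frac{t-c(B)}{1-c(B)}$ if $B$ is a zero-box and $h_{i-1,j},v_{i,j-1}<r(B)-1$; (5) $w(B)=\frac{1-t}{1-c(B)}$ if $B$ is a one-box and $h_{i-1,j},v_{i,j-1}<r(B)-1$; (6) $w(B)=0$ if $B$ is a one-box and $b_{i-1,j-1}$ is a zero-box with $\bar r(b_{i-1,j-1})=r(B)-1$, or $B$ is a zero-box and $b_{i-1,j-1}$ is a one-box with $\bar r(b_{i-1,j-1})=r(B)-1$. Finally $U(\mu\to\rho\mid\lambda\to\nu):=\prod_{i=0}^{m-1}\prod_{j=0}^{n-1}w(b_{i,j})$. For fixed $\lambda,\mu,\nu$ with $\lambda\prec\mu$, $\lambda\prec\nu$ these numbers are non-negative and sum to $1$ over $\rho$. *)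

theory Defs
  imports "HOL-Probability.Probability"
begin

definition Sig :: "nat \<Rightarrow> int list set" where
  "Sig N = {\<kappa>. length \<kappa> = N \<and> sorted_wrt (\<ge>) \<kappa>}"

text \<open>Interlacing of signatures of the same length:
  \<open>\<mu>\<^sub>1 \<ge> \<lambda>\<^sub>1 \<ge> \<mu>\<^sub>2 \<ge> \<lambda>\<^sub>2 \<ge> \<dots> \<ge> \<mu>\<^sub>N \<ge> \<lambda>\<^sub>N\<close>. Lists are indexed from \<open>0\<close>.\<close>

definition interlaces :: "int list \<Rightarrow> int list \<Rightarrow> bool" (infix "\<prec>" 50) where
  "lam \<prec> \<mu> \<longleftrightarrow> length lam = length \<mu> \<and>
     (\<forall>i<length \<mu>. lam ! i \<le> \<mu> ! i) \<and>
     (\<forall>i. Suc i < length \<mu> \<longrightarrow> \<mu> ! Suc i \<le> lam ! i)"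

definition conj_part :: "int list \<Rightarrow> int \<Rightarrow> nat" where
  "conj_part \<kappa> a = card {i. i < length \<kappa> \<and> a \<le> \<kappa> ! i}"

text \<open>One particle of \<open>\<kappa>\<close> at position \<open>k\<close> moves to \<open>k + 1\<close>. Comparing multisets accounts for
  the reordering of the coordinates.\<close>

definition moves :: "int \<Rightarrow> int list \<Rightarrow> int list \<Rightarrow> bool" where
  "moves k \<kappa> \<kappa>' \<longleftrightarrow> k \<in> set \<kappa> \<and> mset \<kappa>' = mset \<kappa> - {#k#} + {#k + 1#}"

text \<open>The positions \<open>h\<^sub>i\<^sub>,\<^sub>j\<close> and \<open>v\<^sub>i\<^sub>,\<^sub>j\<close>. They are unique when a move exists, which
  \<open>admissible\<close> requires.\<close>

definition hpos :: "(nat \<times> nat \<Rightarrow> int list) \<Rightarrow> nat \<Rightarrow> nat \<Rightarrow> int" where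
  "hpos \<Lambda> i j = (THE k. moves k (\<Lambda> (i, j)) (\<Lambda> (Suc i, j)))"

definition vpos :: "(nat \<times> nat \<Rightarrow> int list) \<Rightarrow> nat \<Rightarrow> nat \<Rightarrow> int" where
  "vpos \<Lambda> i j = (THE k. moves k (\<Lambda> (i, j)) (\<Lambda> (i, Suc j)))"

definition admissible ::
  "nat \<Rightarrow> nat \<Rightarrow> nat \<Rightarrow> int list \<Rightarrow> int list \<Rightarrow> int list \<Rightarrow> int list \<Rightarrow> (nat \<times> nat \<Rightarrow> int list) \<Rightarrow> bool"
where
  "admissible N m n \<mu> \<rho> lam \<nu> \<Lambda> \<longleftrightarrow>
     \<Lambda> \<in> ({0..m} \<times> {0..n}) \<rightarrow>\<^sub>E Sig N \<and>
     \<Lambda> (0, 0) = lam \<and> \<Lambda> (m, 0) = \<nu> \<and> \<Lambda> (0, n) = \<mu> \<and> \<Lambda> (m, n) = \<rho> \<and>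
     (\<forall>i<m. \<forall>j\<le>n. \<exists>k. moves k (\<Lambda> (i, j)) (\<Lambda> (Suc i, j))) \<and>
     (\<forall>i\<le>m. \<forall>j<n. \<exists>k. moves k (\<Lambda> (i, j)) (\<Lambda> (i, Suc j))) \<and>
     (\<forall>i j. Suc i < m \<and> j \<le> n \<longrightarrow> hpos \<Lambda> i j < hpos \<Lambda> (Suc i) j) \<and>
     (\<forall>i j. i \<le> m \<and> Suc j < n \<longrightarrow> vpos \<Lambda> i j < vpos \<Lambda> i (Suc j)) \<and>
     (\<forall>i<m. \<forall>j<n. hpos \<Lambda> i j = vpos \<Lambda> i j \<longrightarrow>
        hpos \<Lambda> i (Suc j) = vpos \<Lambda> (Suc i) j \<and>
        vpos \<Lambda> (Suc i) j \<in> {hpos \<Lambda> i j, hpos \<Lambda> i j + 1})"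

definition zero_box :: "(nat \<times> nat \<Rightarrow> int list) \<Rightarrow> nat \<Rightarrow> nat \<Rightarrow> bool" where
  "zero_box \<Lambda> i j \<longleftrightarrow> hpos \<Lambda> i j = vpos \<Lambda> i j \<and>
     hpos \<Lambda> i (Suc j) = hpos \<Lambda> i j \<and> vpos \<Lambda> (Suc i) j = hpos \<Lambda> i j"

definition one_box :: "(nat \<times> nat \<Rightarrow> int list) \<Rightarrow> nat \<Rightarrow> nat \<Rightarrow> bool" where
  "one_box \<Lambda> i j \<longleftrightarrow> hpos \<Lambda> i j = vpos \<Lambda> i j \<and>
     hpos \<Lambda> i (Suc j) = hpos \<Lambda> i j + 1 \<and> vpos \<Lambda> (Suc i) j = hpos \<Lambda> i j + 1"

text \<open>The weight of the box with south-west corner \<open>(i, j)\<close>. The guards \<open>0 < i\<close> and \<open>0 < j\<close>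
  encode that boxes outside the rectangle are trivial and that
  \<open>h\<^bsub>-1,j\<^esub> = v\<^bsub>i,-1\<^esub> = -\<infinity>\<close>; \<open>hL\<close> and \<open>vD\<close> say that \<open>h\<^bsub>i-1,j\<^esub>\<close> and \<open>v\<^bsub>i,j-1\<^esub>\<close> equal
  \<open>r(B) - 1\<close>, and \<open>far\<close> that both are smaller than \<open>r(B) - 1\<close>. \<open>zD\<close> and \<open>oD\<close> say that the
  diagonal neighbour \<open>(i-1, j-1)\<close> is a zero-box resp. one-box whose outgoing position is
  \<open>r(B) - 1\<close>. The cases are mutually exclusive, up to their common value, and exhaustive for
  boxes of an admissible \<open>\<Lambda>\<close>, so their order is immaterial and the last branch is never
  reached.\<close>

definition box_weight :: "real \<Rightarrow> (nat \<times> nat \<Rightarrow> int list) \<Rightarrow> nat \<Rightarrow> nat \<Rightarrow> real" where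
  "box_weight t \<Lambda> i j =
    (let r = hpos \<Lambda> i j;
         c = t ^ count_list (\<Lambda> (i, j)) r;
         Z = zero_box \<Lambda> i j;
         One = one_box \<Lambda> i j;
         oneL = (0 < i \<and> one_box \<Lambda> (i - 1) j);
         oneD = (0 < j \<and> one_box \<Lambda> i (j - 1));
         trivL = (\<not> (0 < i \<and> (zero_box \<Lambda> (i - 1) j \<or> one_box \<Lambda> (i - 1) j)));
         trivD = (\<not> (0 < j \<and> (zero_box \<Lambda> i (j - 1) \<or> one_box \<Lambda> i (j - 1))));
         zD = (0 < i \<and> 0 < j \<and> zero_box \<Lambda> (i - 1) (j - 1) \<and> hpos \<Lambda> (i - 1) j = r - 1);
         oD = (0 < i \<and> 0 < j \<and> one_box \<Lambda> (i - 1) (j - 1) \<and> hpos \<Lambda> (i - 1) j = r - 1);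
         hL = (0 < i \<and> hpos \<Lambda> (i - 1) j = r - 1);
         vD = (0 < j \<and> vpos \<Lambda> i (j - 1) = r - 1);
         far = ((0 < i \<longrightarrow> hpos \<Lambda> (i - 1) j < r - 1) \<and> (0 < j \<longrightarrow> vpos \<Lambda> i (j - 1) < r - 1))
     in if (\<not> Z \<and> \<not> One) \<or> (One \<and> (oneL \<or> oneD)) \<or> (One \<and> oD) \<or> (Z \<and> zD) then 1
        else if Z \<and> hL \<noteq> vD then t
        else if One \<and> trivL \<and> trivD \<and> hL \<noteq> vD then 1 - t
        else if Z \<and> far then (t - c) / (1 - c)
        else if One \<and> far then (1 - t) / (1 - c)
        else if (One \<and> zD) \<or> (Z \<and> oD) then 0
        else undefined)"

text \<open>\<open>U t N \<mu> \<rho> \<lambda> \<nu>\<close> is \<open>U(\<mu> \<rightarrow> \<rho> | \<lambda> \<rightarrow> \<nu>)\<close>. There is at most one admissible \<open>\<Lambda>\<close>, so the choice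
  operator picks the only one.\<close>

definition U :: "real \<Rightarrow> nat \<Rightarrow> int list \<Rightarrow> int list \<Rightarrow> int list \<Rightarrow> int list \<Rightarrow> real" where
  "U t N \<mu> \<rho> lam \<nu> =
    (let m = nat (sum_list \<nu> - sum_list lam); n = nat (sum_list \<mu> - sum_list lam) in
     if lam \<prec> \<mu> \<and> \<mu> \<prec> \<rho> \<and> lam \<prec> \<nu> \<and> \<nu> \<prec> \<rho> \<and>
        sum_list \<nu> - sum_list lam = sum_list \<rho> - sum_list \<mu> \<and>
        (\<exists>\<Lambda>. admissible N m n \<mu> \<rho> lam \<nu> \<Lambda>)
     then \<Prod>i<m. \<Prod>j<n. box_weight t (SOME \<Lambda>. admissible N m n \<mu> \<rho> lam \<nu> \<Lambda>) i j
     else 0)"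

text \<open>The law of the output of the Hall-Littlewood RSK algorithm with input \<open>(\<lambda>, \<mu>, \<nu>)\<close>: the
  discrete measure on \<open>Sig N\<close> with mass \<open>U(\<mu> \<rightarrow> \<rho> | \<lambda> \<rightarrow> \<nu>)\<close> at \<open>\<rho>\<close>.\<close>

definition HL_RSK :: "real \<Rightarrow> nat \<Rightarrow> int list \<Rightarrow> int list \<Rightarrow> int list \<Rightarrow> int list measure" where
  "HL_RSK t N lam \<mu> \<nu> = point_measure (Sig N) (\<lambda>\<rho>. ennreal (U t N \<mu> \<rho> lam \<nu>))"

text \<open>The law of the family \<open>(\<kappa>'\<^sub>a)\<^bsub>a \<le> k\<^esub>\<close> for \<open>\<kappa>\<close> distributed according to \<open>M\<close>. A family
  indexed by \<open>{..k}\<close> is a function that is \<open>undefined\<close> elsewhere. As only countably many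
  families occur, the discrete sigma-algebra can be used on the space of all families.\<close>

definition conj_law :: "int \<Rightarrow> int list measure \<Rightarrow> (int \<Rightarrow> nat) measure" where
  "conj_law k M =
     distr M (count_space ({..k} \<rightarrow>\<^sub>E UNIV)) (\<lambda>\<kappa>. restrict (conj_part \<kappa>) {..k})"

end

theory Submission
  imports Defs
begin

text \<open>
  An admissible \<open>\<Lambda>\<close> is a picture of lines. The \<open>i\<close>-th horizontal move starts at the bottom
  at \<open>h\<^sub>i\<^sub>,\<^sub>0\<close> and climbs through the rows, the \<open>j\<close>-th vertical move starts on the left at
  \<open>v\<^sub>0\<^sub>,\<^sub>j\<close> and traverses row \<open>j\<close>. Positions change only where the two lines crossing in a box
  have the same position, and then they either both keep it (zero-box) or both gain one
  (one-box). The families \<open>{\<kappa>'\<^sub>a}\<close>, \<open>a \<le> k\<close>, of \<open>\<lambda>\<close>, \<open>\<mu>\<close>, \<open>\<nu>\<close> record the starting positions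
  below \<open>k\<close> and the number of particles at each place below \<open>k\<close>; that of \<open>\<rho>\<close> is given by \<open>\<mu>\<close> and
  the final horizontal positions below \<open>k\<close>. As positions never decrease, change only when
  they are equal, and enter the weight of a box at \<open>r\<close> only through the places \<open>r\<close> and
  \<open>r - 1\<close>, what happens at or above \<open>k\<close> cannot influence what happens below. The statement is
  therefore clear as soon as \<open>U\<close> is seen to be the law of a random process that uses only
  local information: the part above \<open>k\<close> is then integrated out with total mass one.

  The process inserts the vertical lines one after another into the increasing list of
  horizontal positions. Strict monotonicity of the next row forces all equal-position boxes of a
  row to be of the same type (\<open>row_recursion\<close>), so a row is described by one bit and computed by
  the recursion \<open>pass\<close>. In the product of the weights of a row only the first such
  box contributes a factor different from one. Its weight depends on the position \<open>v\<close> of the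
  inserted line, on whether \<open>v - 1\<close> is occupied by a horizontal line, on the multiplicity of
  \<open>v\<close> in \<open>\<lambda>\<close>, and on the exit position and kind of the preceding row; its values for the two
  types add up to one (\<open>row_weight\<close>). This turns \<open>U\<close> into the Markov chain \<open>chain\<close>.

  Two facts identify the laws. The weight of any admissible \<open>\<Lambda>\<close> is the probability that the
  chain produces its top row and right column (\<open>diagram_weight\<close>), and each outcome of the chain
  comes from an admissible \<open>\<Lambda>\<close> (\<open>extend\<close>, \<open>extend_chain\<close>): a zero-box needs a second particle at
  its position, and the choices for which there is none have probability zero. Since the top
  row and the right column are determined by \<open>\<mu>\<close>, \<open>\<nu>\<close> and \<open>\<rho>\<close>, the law of \<open>\<rho>\<close> is an image of the
  law of the chain (\<open>U_eq_pmf\<close>); in particular the numbers \<open>U\<close> sum to one. The truncated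
  chains for two inputs are compared by induction on the inserted positions below \<open>k\<close>
  (\<open>filter_chain_cong\<close>).
\<close>

section \<open>Signatures and particle moves\<close>

lemma conj_part_mset: "conj_part \<kappa> a = size {#x \<in># mset \<kappa>. a \<le> x#}"
proof -
  have "conj_part \<kappa> a = length (filter (\<lambda>x. a \<le> x) \<kappa>)"
    by (simp add: conj_part_def length_filter_conv_card)
  then show ?thesis by (metis mset_filter size_mset)
qed

text \<open>A signature is weakly decreasing, so the indices of the coordinates \<open>\<ge> a\<close> form an
  initial segment. Through this Galois connection interlacing and equality of
  signatures become statements about \<open>conj_part\<close>, where a particle move is a single increment.\<close>

lemma le_nth_iff:
  assumes "\<kappa> \<in> Sig N" "i < N"
  shows "a \<le> \<kappa> ! i \<longleftrightarrow> i < conj_part \<kappa> a"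
proof -
  let ?S = "{i. i < length \<kappa> \<and> a \<le> \<kappa> ! i}"
  have len: "length \<kappa> = N" and dec: "\<And>p q. p \<le> q \<Longrightarrow> q < N \<Longrightarrow> \<kappa> ! q \<le> \<kappa> ! p"
    using assms(1) by (auto simp: Sig_def sorted_wrt_iff_nth_less order_le_less)
  show ?thesis
  proof
    assume "a \<le> \<kappa> ! i"
    then have "{..i} \<subseteq> ?S" using dec len assms(2) by fastforce
    then have "card {..i} \<le> card ?S" by (intro card_mono) auto
    then show "i < conj_part \<kappa> a" by (simp add: conj_part_def)
  next
    assume i: "i < conj_part \<kappa> a"
    show "a \<le> \<kappa> ! i"
    proof (rule ccontr)
      assume "\<not> a \<le> \<kappa> ! i"
      then have "j < i" if "j \<in> ?S" for j using dec[of i j] len that by force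
      then have "?S \<subseteq> {..<i}" by blast
      then have "card ?S \<le> card {..<i}" by (intro card_mono) auto
      then show False using i by (simp add: conj_part_def)
    qed
  qed
qed

lemma Sig_eqI:
  assumes "\<kappa> \<in> Sig N" "\<kappa>' \<in> Sig N" "\<And>a. conj_part \<kappa> a = conj_part \<kappa>' a"
  shows "\<kappa> = \<kappa>'"
proof (rule nth_equalityI)
  show "length \<kappa> = length \<kappa>'" using assms by (simp add: Sig_def)
  fix i assume "i < length \<kappa>"
  then have "i < N" using assms by (simp add: Sig_def)
  then have "a \<le> \<kappa> ! i \<longleftrightarrow> a \<le> \<kappa>' ! i" for a
    using assms by (simp add: le_nth_iff)
  then show "\<kappa> ! i = \<kappa>' ! i" by (metis order.antisym order.refl)
qed

lemma interlaces_conj_part_iff: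
  assumes "\<kappa> \<in> Sig N" "\<kappa>' \<in> Sig N"
  shows "interlaces \<kappa> \<kappa>' \<longleftrightarrow> (\<forall>a. conj_part \<kappa> a \<le> conj_part \<kappa>' a \<and> conj_part \<kappa>' a \<le> Suc (conj_part \<kappa> a))"
    (is "?L \<longleftrightarrow> ?R")
proof
  have len: "length \<kappa> = N" "length \<kappa>' = N" using assms by (auto simp: Sig_def)
  have le_N: "conj_part \<kappa> a \<le> N" "conj_part \<kappa>' a \<le> N" for a
    unfolding conj_part_def using len card_mono[of "{..<N}"]
    by (metis (no_types, lifting) card_lessThan finite_lessThan lessThan_iff mem_Collect_eq subsetI)+
  assume L: ?L
  show ?R
  proof (intro allI conjI)
    fix a
    show "conj_part \<kappa> a \<le> conj_part \<kappa>' a"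
    proof (rule ccontr)
      assume A: "\<not> ?thesis"
      let ?i = "conj_part \<kappa>' a"
      have i: "?i < N" using A le_N(1)[of a] by simp
      then have "a \<le> \<kappa> ! ?i" using A le_nth_iff[OF assms(1) i] by simp
      also have "\<dots> \<le> \<kappa>' ! ?i" using L i len by (simp add: interlaces_def)
      finally show False using le_nth_iff[OF assms(2) i] by simp
    qed
    show "conj_part \<kappa>' a \<le> Suc (conj_part \<kappa> a)"
    proof (rule ccontr)
      assume A: "\<not> ?thesis"
      let ?i = "conj_part \<kappa> a"
      have i: "Suc ?i < N" using A le_N(2)[of a] by simp
      then have "a \<le> \<kappa>' ! Suc ?i" using A le_nth_iff[OF assms(2) i] by simp
      also have "\<dots> \<le> \<kappa> ! ?i" using L i len by (simp add: interlaces_def)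
      finally show False using le_nth_iff[OF assms(1), of ?i] i by simp
    qed
  qed
next
  have len: "length \<kappa> = N" "length \<kappa>' = N" using assms by (auto simp: Sig_def)
  assume R: ?R
  have "\<kappa> ! i \<le> \<kappa>' ! i" if "i < N" for i
    using le_nth_iff[OF assms(1) that, of "\<kappa> ! i"] le_nth_iff[OF assms(2) that, of "\<kappa> ! i"] R
    by (meson order.refl order.strict_trans2)
  moreover have "\<kappa>' ! Suc i \<le> \<kappa> ! i" if "Suc i < N" for i
    using le_nth_iff[OF assms(2) that, of "\<kappa>' ! Suc i"]
      le_nth_iff[OF assms(1), of i "\<kappa>' ! Suc i"] R that
    by (metis Suc_lessD Suc_less_eq order.refl order.strict_trans2)
  ultimately show ?L using len by (simp add: interlaces_def)
qed

text \<open>The multiplicity at \<open>a\<close> is visible to the family up to \<open>a + 1\<close>. This is why the multiplicities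
  at places \<open>< k\<close> are determined by the family up to \<open>k\<close>.\<close>

lemma count_list_conj_part:
  "conj_part \<kappa> a = count_list \<kappa> a + conj_part \<kappa> (a + 1)"
proof -
  have "{#x \<in># M. a \<le> x#} = replicate_mset (count M a) a + {#x \<in># M. a + 1 \<le> x#}" for M :: "int multiset"
    by (rule multiset_eqI) (auto simp: order_le_less)
  then show ?thesis by (simp add: conj_part_mset count_mset)
qed

definition advance :: "int \<Rightarrow> int list \<Rightarrow> int list" where
  "advance k \<kappa> = rev (sorted_list_of_multiset (mset \<kappa> - {#k#} + {#k + 1#}))"

lemma mset_advance: "mset (advance k \<kappa>) = mset \<kappa> - {#k#} + {#k + 1#}"
  by (simp add: advance_def)

lemma advance_in_Sig:
  assumes "\<kappa> \<in> Sig N" "k \<in> set \<kappa>"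
  shows "advance k \<kappa> \<in> Sig N"
proof -
  have "length (advance k \<kappa>) = size (mset (advance k \<kappa>))" by simp
  also have "\<dots> = length \<kappa>" unfolding mset_advance
    using assms(2) by (metis add_mset_add_single insert_DiffM set_mset_mset size_add_mset size_mset)
  finally have "length (advance k \<kappa>) = N" using assms by (simp add: Sig_def)
  moreover have "sorted_wrt (\<ge>) (advance k \<kappa>)"
    unfolding advance_def sorted_wrt_rev
    using sorted_sorted_list_of_multiset[of "mset \<kappa> - {#k#} + {#k + 1#}"] by simp
  ultimately show ?thesis by (simp add: Sig_def)
qed

lemma moves_iff_advance:
  assumes "\<kappa>' \<in> Sig N"
  shows "moves k \<kappa> \<kappa>' \<longleftrightarrow> k \<in> set \<kappa> \<and> \<kappa>' = advance k \<kappa>"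
proof -
  have "\<kappa>' = advance k \<kappa>" if "mset \<kappa>' = mset \<kappa> - {#k#} + {#k + 1#}"
  proof -
    have "sorted (rev \<kappa>')" using assms by (simp add: Sig_def sorted_wrt_rev)
    then have "rev \<kappa>' = sort \<kappa>'" by (metis mset_rev properties_for_sort)
    also have "\<dots> = sorted_list_of_multiset (mset \<kappa>')" by simp
    finally have "rev \<kappa>' = sorted_list_of_multiset (mset \<kappa> - {#k#} + {#k + 1#})"
      unfolding that .
    then show ?thesis unfolding advance_def by (metis rev_rev_ident)
  qed
  then show ?thesis by (auto simp: moves_def mset_advance)
qed

lemma moves_advance: "k \<in> set \<kappa> \<Longrightarrow> moves k \<kappa> (advance k \<kappa>)"
  by (simp add: moves_def mset_advance)

lemma count_list_advance:
  "k \<in> set \<kappa> \<Longrightarrow> count_list (advance k \<kappa>) x + of_bool (x = k) = count_list \<kappa> x + of_bool (x = k + 1)"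
proof -
  assume "k \<in> set \<kappa>"
  then obtain M where M: "mset \<kappa> = add_mset k M" by (metis insert_DiffM set_mset_mset)
  show ?thesis unfolding count_mset[symmetric] mset_advance M by simp
qed

lemma conj_part_advance:
  assumes "k \<in> set \<kappa>"
  shows "conj_part (advance k \<kappa>) a = conj_part \<kappa> a + of_bool (a = k + 1)"
proof -
  obtain M where M: "mset \<kappa> = add_mset k M"
    using assms by (metis insert_DiffM set_mset_mset)
  show ?thesis unfolding conj_part_mset mset_advance M by auto
qed

lemma sum_list_advance:
  assumes "k \<in> set \<kappa>"
  shows "sum_list (advance k \<kappa>) = sum_list \<kappa> + 1"
proof -
  obtain M where M: "mset \<kappa> = add_mset k M"
    using assms by (metis insert_DiffM set_mset_mset)
  have "sum_mset (mset (advance k \<kappa>)) = sum_mset (mset \<kappa>) + 1" unfolding mset_advance M by simp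
  then show ?thesis by (simp add: sum_mset_sum_list)
qed

lemma in_set_advance: "k \<in> set \<kappa> \<Longrightarrow> x \<in> set \<kappa> \<Longrightarrow> x \<noteq> k \<Longrightarrow> x \<in> set (advance k \<kappa>)"
  by (metis UnI1 in_diff_count mset_advance count_single set_mset_mset set_mset_union in_multiset_in_set
      count_greater_zero_iff)

lemma in_set_advance_target: "k + 1 \<in> set (advance k \<kappa>)"
  by (metis add_mset_add_single mset_advance set_mset_mset union_single_eq_member)

lemma advance_inj:
  assumes "k \<in> set \<kappa>" "k' \<in> set \<kappa>" "advance k \<kappa> = advance k' \<kappa>"
  shows "k = k'"
  using conj_part_advance[OF assms(1), of "k + 1"] conj_part_advance[OF assms(2), of "k + 1"] assms(3)
  by (simp add: of_bool_def split: if_splits)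

fun movable :: "int list \<Rightarrow> int list \<Rightarrow> bool" where
  "movable \<kappa> [] \<longleftrightarrow> True"
| "movable \<kappa> (k # ks) \<longleftrightarrow> k \<in> set \<kappa> \<and> movable (advance k \<kappa>) ks"

lemma movable_append:
  "movable \<kappa> (ks @ ls) \<longleftrightarrow> movable \<kappa> ks \<and> movable (fold advance ks \<kappa>) ls"
  by (induction ks arbitrary: \<kappa>) auto

lemma fold_advance_in_Sig: "\<kappa> \<in> Sig N \<Longrightarrow> movable \<kappa> ks \<Longrightarrow> fold advance ks \<kappa> \<in> Sig N"
  by (induction ks arbitrary: \<kappa>) (auto simp: advance_in_Sig)

lemma conj_part_fold_advance:
  "movable \<kappa> ks \<Longrightarrow> conj_part (fold advance ks \<kappa>) a = conj_part \<kappa> a + count_list ks (a - 1)"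
  by (induction ks arbitrary: \<kappa>) (auto simp: conj_part_advance)

lemma sum_list_fold_advance:
  "movable \<kappa> ks \<Longrightarrow> sum_list (fold advance ks \<kappa>) = sum_list \<kappa> + int (length ks)"
  by (induction ks arbitrary: \<kappa>) (auto simp: sum_list_advance)

lemma count_list_le_1: "sorted_wrt (<) (ks :: int list) \<Longrightarrow> count_list ks a = of_bool (a \<in> set ks)"
  by (induction ks) (auto simp: count_list_0_iff)

text \<open>An increasing list of moves is recovered from its endpoints, because it moves at most
  one particle from each place. Hence all four sides of a diagram are determined by its corners.\<close>

lemma movable_unique:
  assumes "movable \<kappa> ks" "movable \<kappa> ls" "sorted_wrt (<) ks" "sorted_wrt (<) ls"
    "fold advance ks \<kappa> = fold advance ls \<kappa>"
  shows "ks = ls"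
proof -
  have "count_list ks a = count_list ls a" for a
    using conj_part_fold_advance[OF assms(1), of "a + 1"] conj_part_fold_advance[OF assms(2), of "a + 1"] assms(5)
    by simp
  then have "set ks = set ls" using assms(3,4) by (simp add: count_list_le_1 set_eq_iff of_bool_eq_iff)
  then show ?thesis using assms(3,4) by (simp add: strict_sorted_equal)
qed

lemma interlaces_fold_advance:
  assumes "\<kappa> \<in> Sig N" "movable \<kappa> ks" "sorted_wrt (<) ks"
  shows "interlaces \<kappa> (fold advance ks \<kappa>)"
  unfolding interlaces_conj_part_iff[OF assms(1) fold_advance_in_Sig[OF assms(1,2)]]
  by (auto simp: conj_part_fold_advance[OF assms(2)] count_list_le_1[OF assms(3)])

text \<open>The moves are performed from the lowest place upwards: at the lowest place \<open>k\<close> nothing arrives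
  from \<open>k - 1\<close>, so the departing particle is already present.\<close>

lemma ex_movable_of_set:
  assumes "finite S" "\<kappa> \<in> Sig N" "\<kappa>' \<in> Sig N"
    "\<And>a. conj_part \<kappa>' a = conj_part \<kappa> a + of_bool (a - 1 \<in> S)"
  shows "\<exists>ks. sorted_wrt (<) ks \<and> set ks = S \<and> movable \<kappa> ks \<and> fold advance ks \<kappa> = \<kappa>'"
  using assms
proof (induction S arbitrary: \<kappa> rule: finite_linorder_min_induct)
  case empty
  then show ?case using Sig_eqI by (intro exI[of _ "[]"]) auto
next
  case (insert k S)
  have "conj_part \<kappa>' (k + 1) \<le> conj_part \<kappa>' k"
    using count_list_conj_part[of \<kappa>' k] by simp
  moreover have "k - 1 \<notin> insert k S" using insert.hyps by force
  ultimately have "conj_part \<kappa> (k + 1) < conj_part \<kappa> k"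
    using insert.prems(3)[of k] insert.prems(3)[of "k + 1"] by simp
  then have k: "k \<in> set \<kappa>"
    using count_list_conj_part[of \<kappa> k] count_list_0_iff[of \<kappa> k] by linarith
  have kS: "k \<notin> S" using insert.hyps by auto
  have "conj_part \<kappa>' a = conj_part (advance k \<kappa>) a + of_bool (a - 1 \<in> S)" for a
    using insert.prems(3)[of a] kS by (auto simp: conj_part_advance[OF k])
  then obtain ks where "sorted_wrt (<) ks" "set ks = S" "movable (advance k \<kappa>) ks"
    "fold advance ks (advance k \<kappa>) = \<kappa>'"
    using insert.IH[OF advance_in_Sig[OF insert.prems(1) k] insert.prems(2)] by blast
  then show ?case using k insert.hyps by (intro exI[of _ "k # ks"]) auto
qed

lemma interlaces_ex_movable:
  assumes "\<kappa> \<in> Sig N" "\<kappa>' \<in> Sig N" "interlaces \<kappa> \<kappa>'"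
  obtains ks where "sorted_wrt (<) ks" "movable \<kappa> ks" "fold advance ks \<kappa> = \<kappa>'"
    "set ks = {a. conj_part \<kappa> (a + 1) \<noteq> conj_part \<kappa>' (a + 1)}"
proof -
  let ?S = "{a. conj_part \<kappa> (a + 1) \<noteq> conj_part \<kappa>' (a + 1)}"
  have bd: "conj_part \<kappa> a \<le> conj_part \<kappa>' a" "conj_part \<kappa>' a \<le> Suc (conj_part \<kappa> a)" for a
    using interlaces_conj_part_iff[OF assms(1,2)] assms(3) by auto
  have len: "length \<kappa> = length \<kappa>'" using assms by (simp add: interlaces_def)
  have "?S \<subseteq> (\<Union>i<length \<kappa>. {\<kappa> ! i .. \<kappa>' ! i})"
  proof
    fix a assume "a \<in> ?S"
    then have "conj_part \<kappa> (a + 1) < conj_part \<kappa>' (a + 1)" using bd[of "a + 1"] by auto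
    then have "\<not> {i. i < length \<kappa>' \<and> a + 1 \<le> \<kappa>' ! i} \<subseteq> {i. i < length \<kappa> \<and> a + 1 \<le> \<kappa> ! i}"
      using card_mono[of "{i. i < length \<kappa> \<and> a + 1 \<le> \<kappa> ! i}" "{i. i < length \<kappa>' \<and> a + 1 \<le> \<kappa>' ! i}"]
      unfolding conj_part_def by (auto simp del: not_le simp add: leD)
    then obtain i where "i < length \<kappa>" "a + 1 \<le> \<kappa>' ! i" "\<not> a + 1 \<le> \<kappa> ! i" using len by auto
    then show "a \<in> (\<Union>i<length \<kappa>. {\<kappa> ! i .. \<kappa>' ! i})" by (auto intro!: bexI[of _ i])
  qed
  then have fin: "finite ?S" by (rule finite_subset) auto
  have "conj_part \<kappa>' a = conj_part \<kappa> a + of_bool (a - 1 \<in> ?S)" for a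
    using bd[of a] by auto
  from ex_movable_of_set[OF fin assms(1,2) this] show ?thesis using that by blast
qed

section \<open>Inserting one vertical line\<close>

text \<open>A vertical line at position \<open>v\<close> traverses the horizontal positions \<open>hs\<close>; the bit \<open>b\<close> says
  whether boxes with equal positions are one-boxes or zero-boxes. The result consists of the new
  horizontal positions and the exit position of the vertical line.\<close>

fun pass :: "bool \<Rightarrow> int \<Rightarrow> int list \<Rightarrow> int list \<times> int" where
  "pass b v [] = ([], v)"
| "pass b v (h # hs) =
     (if h = v \<and> b then (let (hs', u) = pass b (v + 1) hs in ((h + 1) # hs', u))
      else (let (hs', u) = pass b v hs in (h # hs', u)))"

lemma pass_append:
  "pass b v (xs @ ys) = (fst (pass b v xs) @ fst (pass b (snd (pass b v xs)) ys),
     snd (pass b (snd (pass b v xs)) ys))"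
  by (induction xs arbitrary: v) (auto simp: case_prod_beta Let_def)

lemma pass_False: "pass False v hs = (hs, v)"
  by (induction hs) auto

lemma pass_disjoint: "v \<notin> set hs \<Longrightarrow> pass b v hs = (hs, v)"
  by (induction hs) auto

lemma le_snd_pass: "v \<le> snd (pass b v hs)"
proof (induction hs arbitrary: v)
  case (Cons h hs)
  show ?case using Cons[of v] Cons[of "v + 1"] by (auto simp: case_prod_beta Let_def)
qed simp

lemma less_snd_pass_True: "v \<in> set hs \<Longrightarrow> v < snd (pass True v hs)"
proof (induction hs)
  case (Cons h hs)
  then show ?case using le_snd_pass[of "v + 1" True hs] by (auto simp: case_prod_beta Let_def)
qed simp

lemma pass_eq_rec:
  fixes h h' v :: "nat \<Rightarrow> int"
  assumes "\<And>i. i < m \<Longrightarrow> v (Suc i) = (if b \<and> h i = v i then v i + 1 else v i)"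
    "\<And>i. i < m \<Longrightarrow> h' i = (if b \<and> h i = v i then h i + 1 else h i)"
  shows "pass b (v 0) (map h [0..<m]) = (map h' [0..<m], v m)"
  using assms by (induction m) (auto simp: pass_append)

lemma set_pass_bound:
  "\<forall>x\<in>set hs. l < x \<Longrightarrow> \<forall>x\<in>set (fst (pass b v hs)). l < x"
  by (induction hs arbitrary: v) (auto simp: case_prod_beta Let_def)

text \<open>If an entry increases, the vertical line increases with it and pushes the next entry
  should that be adjacent; so no two entries can become equal.\<close>

lemma sorted_pass:
  "sorted_wrt (<) hs \<Longrightarrow> sorted_wrt (<) (fst (pass b v hs))"
proof (induction hs arbitrary: v)
  case (Cons h hs)
  have "\<forall>x\<in>set (fst (pass b v hs)). h < x" for v
    using Cons.prems by (intro set_pass_bound) auto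
  moreover have "\<forall>x\<in>set (fst (pass True (h + 1) hs)). h + 1 < x"
  proof (cases hs)
    case (Cons g gs)
    have g: "h + 1 \<le> g" "\<forall>x\<in>set gs. h + 1 < x" using Cons.prems Cons by auto
    show ?thesis
      using g set_pass_bound[of gs "h + 1"]
      by (auto simp: Cons case_prod_beta Let_def)
  qed auto
  ultimately show ?case using Cons by (auto simp: case_prod_beta Let_def)
qed simp

section \<open>The random insertion\<close>

text \<open>What the previous row did: it had no equal-position box, only zero-boxes, or one-boxes. A row
  with an equal-position box has the entering position among its horizontal
  positions, since the first such box is met with that position.\<close>

datatype row_kind = Free | Stay | Push

definition kind_of :: "bool \<Rightarrow> int \<Rightarrow> int list \<Rightarrow> row_kind" where
  "kind_of b v hs = (if v \<notin> set hs then Free else if b then Push else Stay)"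

text \<open>The probability of a one-box when the preceding vertical line exits below
  \<open>v - 1\<close>: rules (3) and (5) of the weights. In rule (5) the
  multiplicity in \<open>\<lambda>\<close> replaces that in \<open>\<Lambda>(i, j)\<close>, by \<open>count_far\<close>.\<close>

definition base_prob :: "real \<Rightarrow> int list \<Rightarrow> int list \<Rightarrow> int \<Rightarrow> real" where
  "base_prob t lam hs v =
     (if v - 1 \<in> set hs then 1 - t else (1 - t) / (1 - t ^ count_list lam v))"

text \<open>Here \<open>u\<close> is the exit position of the preceding vertical line. If it is at least \<open>v - 1\<close>, the
  kind of the preceding row decides. After a row with one-boxes the line has to be pushed: below or at \<open>u\<close>,
  to keep the exit positions increasing, and at \<open>u + 1\<close> by rules (1) and (6). After a row with
  zero-boxes only \<open>v = u + 1\<close> is possible, and rules (1) and (6) demand a zero-box. After a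
  free row, again with \<open>v = u + 1\<close>, exactly one of the two neighbouring positions is
  \<open>v - 1\<close>, so that rules (2) and (3) apply. For the first row there is no preceding line.\<close>

fun push_prob :: "real \<Rightarrow> int list \<Rightarrow> (int \<times> row_kind) option \<Rightarrow> int list \<Rightarrow> int \<Rightarrow> real" where
  "push_prob t lam None hs v = base_prob t lam hs v"
| "push_prob t lam (Some (u, q)) hs v =
     (if v \<le> u + 1 then (case q of Free \<Rightarrow> 1 - t | Stay \<Rightarrow> 0 | Push \<Rightarrow> 1)
      else base_prob t lam hs v)"

lemma base_prob_bounds:
  assumes "0 \<le> t" "t < 1"
  shows "0 \<le> base_prob t lam hs v" "base_prob t lam hs v \<le> 1"
proof -
  let ?n = "count_list lam v"
  have "t ^ ?n = 1 \<or> t ^ ?n \<le> t"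
    using assms power_decreasing[of 1 ?n t] by (cases ?n) auto
  then have "0 \<le> (1 - t) / (1 - t ^ ?n) \<and> (1 - t) / (1 - t ^ ?n) \<le> 1"
    using assms by (auto simp: divide_le_eq_1)
  then show "0 \<le> base_prob t lam hs v" "base_prob t lam hs v \<le> 1"
    using assms by (auto simp: base_prob_def)
qed

lemma push_prob_bounds:
  assumes "0 \<le> t" "t < 1"
  shows "0 \<le> push_prob t lam prev hs v" "push_prob t lam prev hs v \<le> 1"
  using assms base_prob_bounds[OF assms]
  by (cases "(t, lam, prev, hs, v)" rule: push_prob.cases; simp split: row_kind.split)+

text \<open>If the line meets no horizontal line, the type of the boxes has no effect. It is then fixed to
  \<open>True\<close>, because the argument for pushed lines in \<open>extend\<close>, that they stay above their
  predecessors, covers such lines as well.\<close>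

definition mode_pmf :: "real \<Rightarrow> int list \<Rightarrow> (int \<times> row_kind) option \<Rightarrow> int list \<Rightarrow> int \<Rightarrow> bool pmf" where
  "mode_pmf t lam prev hs v =
     (if v \<in> set hs then bernoulli_pmf (push_prob t lam prev hs v) else return_pmf True)"

text \<open>Besides the final horizontal positions, the exit positions of the
  vertical lines are recorded: they reveal the bit of every row, so that each
  recorded outcome arises in a single way and its probability is a product
  instead of a sum of products.\<close>

fun chain :: "real \<Rightarrow> int list \<Rightarrow> (int \<times> row_kind) option \<Rightarrow> int list \<Rightarrow> int list
    \<Rightarrow> (int list \<times> int list) pmf" where
  "chain t lam prev hs [] = return_pmf (hs, [])"
| "chain t lam prev hs (v # vs) = mode_pmf t lam prev hs v \<bind> (\<lambda>b.
     map_pmf (\<lambda>(x, us). (x, snd (pass b v hs) # us))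
       (chain t lam (Some (snd (pass b v hs), kind_of b v hs)) (fst (pass b v hs)) vs))"

lemma pmf_map_cons:
  "pmf (map_pmf (\<lambda>(x, us). (x, e # us)) C) (y, u # us) = (if e = u then pmf C (y, us) else 0)"
proof (cases "e = u")
  case True
  have "inj (\<lambda>(x, us). (x, e # us))" by (auto simp: inj_def)
  from pmf_map_inj'[OF this, of C "(y, us)"] True show ?thesis by simp
next
  case False
  then show ?thesis by (auto simp: pmf_eq_0_set_pmf)
qed

text \<open>The other bit would lead to a different exit position.\<close>

lemma pmf_chain_Cons:
  assumes "snd (pass b v hs) = u" "v \<notin> set hs \<Longrightarrow> b"
  shows "pmf (chain t lam prev hs (v # vs)) (x, u # us) =
    pmf (mode_pmf t lam prev hs v) b *
    pmf (chain t lam (Some (u, kind_of b v hs)) (fst (pass b v hs)) vs) (x, us)"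
proof (cases "v \<in> set hs")
  case True
  have ne: "snd (pass (\<not> b) v hs) \<noteq> u"
    using assms(1) less_snd_pass_True[OF True] by (cases b) (auto simp: pass_False)
  have "pmf (chain t lam prev hs (v # vs)) (x, u # us) =
    (\<Sum>c\<in>{b, \<not> b}. pmf (mode_pmf t lam prev hs v) c *
      (if snd (pass c v hs) = u then pmf (chain t lam (Some (snd (pass c v hs), kind_of c v hs)) (fst (pass c v hs)) vs) (x, us) else 0))"
    unfolding chain.simps pmf_bind pmf_map_cons
    by (subst integral_measure_pmf[of "{b, \<not> b}"]) (auto simp: mult.commute)
  also have "\<dots> = pmf (mode_pmf t lam prev hs v) b *
    pmf (chain t lam (Some (u, kind_of b v hs)) (fst (pass b v hs)) vs) (x, us)"
    using ne assms(1) by simp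
  finally show ?thesis .
next
  case False
  then have "b" using assms(2) by simp
  then show ?thesis using False assms(1)
    by (simp add: mode_pmf_def bind_return_pmf pmf_map_cons)
qed

section \<open>Truncation of the random insertion\<close>

lemma filter_pass_high:
  "k \<le> v \<Longrightarrow> filter (\<lambda>x. x < k) (fst (pass b v hs)) = filter (\<lambda>x. x < k) hs"
  by (induction hs arbitrary: v) (auto simp: case_prod_beta Let_def)

lemma pass_high:
  assumes "\<forall>x\<in>set hs. k \<le> x"
  shows "filter (\<lambda>x. x < k) (fst (pass b v hs)) = []"
    "min k (snd (pass b v hs)) = min k v"
proof -
  have "\<forall>x\<in>set (fst (pass b v hs)). k - 1 < x" using assms by (intro set_pass_bound) auto
  then show "filter (\<lambda>x. x < k) (fst (pass b v hs)) = []" by (auto simp: filter_empty_conv)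
  show "min k (snd (pass b v hs)) = min k v"
  proof (cases "v < k")
    case True
    then show ?thesis using assms by (subst pass_disjoint) auto
  next
    case False
    then show ?thesis using le_snd_pass[of v b hs] by simp
  qed
qed

lemma sorted_filter_split:
  "sorted_wrt (<) (hs :: int list) \<Longrightarrow> hs = filter (\<lambda>x. x < k) hs @ filter (\<lambda>x. k \<le> x) hs"
proof (induction hs)
  case (Cons h hs)
  have "filter (\<lambda>x. x < k) hs = []" if "k \<le> h" using Cons.prems that by (auto simp: filter_empty_conv)
  then show ?case using Cons by auto
qed simp

text \<open>Positions \<open>\<ge> k\<close> come last in the increasing list. Until it reaches them the vertical line has seen
  positions \<open>< k\<close> only, and afterwards it changes nothing below \<open>k\<close>.\<close>

lemma pass_low:
  assumes "sorted_wrt (<) hs"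
  shows "filter (\<lambda>x. x < k) (fst (pass b v hs)) = filter (\<lambda>x. x < k) (fst (pass b v (filter (\<lambda>x. x < k) hs)))"
    "min k (snd (pass b v hs)) = min k (snd (pass b v (filter (\<lambda>x. x < k) hs)))"
proof -
  have *: "\<forall>x\<in>set (filter (\<lambda>x. k \<le> x) hs). k \<le> x" by simp
  note s = sorted_filter_split[OF assms, of k]
  show "filter (\<lambda>x. x < k) (fst (pass b v hs)) = filter (\<lambda>x. x < k) (fst (pass b v (filter (\<lambda>x. x < k) hs)))"
    by (subst s, subst pass_append) (simp add: pass_high[OF *] del: filter_filter)
  show "min k (snd (pass b v hs)) = min k (snd (pass b v (filter (\<lambda>x. x < k) hs)))"
    by (subst s, subst pass_append) (simp add: pass_high[OF *])
qed

text \<open>Lines inserted at positions \<open>\<ge> k\<close> leave the part below \<open>k\<close> unchanged; as the bits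
  are chosen with total probability one, such lines disappear from the truncated law.\<close>

lemma filter_chain_high:
  assumes "\<forall>v\<in>set vs. k \<le> v"
  shows "map_pmf (\<lambda>(x, us). filter (\<lambda>a. a < k) x) (chain t lam prev hs vs)
    = return_pmf (filter (\<lambda>a. a < k) hs)"
  using assms
proof (induction vs arbitrary: prev hs)
  case (Cons v vs)
  have *: "map_pmf (\<lambda>(x, us). filter (\<lambda>a. a < k) x) (map_pmf (\<lambda>(x, us). (x, e # us)) C)
     = map_pmf (\<lambda>(x, us). filter (\<lambda>a. a < k) x) C" for e :: int and C :: "(int list \<times> int list) pmf"
    by (simp add: map_pmf_comp case_prod_unfold)
  show ?case using Cons by (simp add: map_bind_pmf * filter_pass_high)
qed simp

lemma base_prob_cong:
  assumes "v < k" "\<forall>a<k. count_list lam1 a = count_list lam2 a"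
    "filter (\<lambda>a. a < k) hs1 = filter (\<lambda>a. a < k) hs2"
  shows "base_prob t lam1 hs1 v = base_prob t lam2 hs2 v"
proof -
  have "v - 1 \<in> set hs1 \<longleftrightarrow> v - 1 \<in> set hs2"
    using arg_cong[OF assms(3), of "\<lambda>xs. v - 1 \<in> set xs"] assms(1) by simp
  then show ?thesis using assms by (simp add: base_prob_def)
qed

text \<open>Of the preceding exit position only its truncation is known. That suffices for inserting
  \<open>v < k\<close>, because the exit position is only tested against \<open>v - 1 < k\<close>.\<close>

definition prev_low :: "int \<Rightarrow> (int \<times> row_kind) option \<Rightarrow> (int \<times> row_kind) option" where
  "prev_low k = map_option (apfst (min k))"

lemma push_prob_cong:
  assumes "v < k" "\<forall>a<k. count_list lam1 a = count_list lam2 a"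
    "filter (\<lambda>a. a < k) hs1 = filter (\<lambda>a. a < k) hs2" "prev_low k prev1 = prev_low k prev2"
  shows "push_prob t lam1 prev1 hs1 v = push_prob t lam2 prev2 hs2 v"
proof (cases prev1)
  case None
  then have "prev2 = None" using assms(4) by (simp add: prev_low_def)
  then show ?thesis using None base_prob_cong[OF assms(1-3)] by simp
next
  case (Some p)
  then obtain u1 u2 q where p: "prev1 = Some (u1, q)" "prev2 = Some (u2, q)" "min k u1 = min k u2"
    using assms(4) by (cases prev2; cases p) (auto simp: prev_low_def)
  then have "v \<le> u1 + 1 \<longleftrightarrow> v \<le> u2 + 1" using assms(1) by linarith
  then show ?thesis using p base_prob_cong[OF assms(1-3)] by simp
qed

text \<open>The two chains can have different numbers of horizontal and vertical lines, but their parts below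
  \<open>k\<close> make the same choices with the same probabilities.\<close>

lemma filter_chain_cong:
  assumes "\<forall>a<k. count_list lam1 a = count_list lam2 a"
    "\<forall>v\<in>set ls. v < k" "\<forall>v\<in>set gs1. k \<le> v" "\<forall>v\<in>set gs2. k \<le> v"
    "sorted_wrt (<) hs1" "sorted_wrt (<) hs2"
    "filter (\<lambda>a. a < k) hs1 = filter (\<lambda>a. a < k) hs2" "prev_low k prev1 = prev_low k prev2"
  shows "map_pmf (\<lambda>(x, us). filter (\<lambda>a. a < k) x) (chain t lam1 prev1 hs1 (ls @ gs1))
    = map_pmf (\<lambda>(x, us). filter (\<lambda>a. a < k) x) (chain t lam2 prev2 hs2 (ls @ gs2))"
  using assms
proof (induction ls arbitrary: prev1 prev2 hs1 hs2)
  case Nil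
  then show ?case by (simp add: filter_chain_high)
next
  case (Cons v ls)
  have *: "map_pmf (\<lambda>(x, us). filter (\<lambda>a. a < k) x) (map_pmf (\<lambda>(x, us). (x, e # us)) C)
     = map_pmf (\<lambda>(x, us). filter (\<lambda>a. a < k) x) C" for e :: int and C :: "(int list \<times> int list) pmf"
    by (simp add: map_pmf_comp case_prod_unfold)
  have v: "v < k" using Cons.prems by simp
  have mem: "v \<in> set hs1 \<longleftrightarrow> v \<in> set hs2"
    using arg_cong[OF Cons.prems(7), of "\<lambda>xs. v \<in> set xs"] v by simp
  have "mode_pmf t lam1 prev1 hs1 v = mode_pmf t lam2 prev2 hs2 v"
    using push_prob_cong[OF v Cons.prems(1,7,8)] mem by (simp add: mode_pmf_def)
  moreover have "map_pmf (\<lambda>(x, us). filter (\<lambda>a. a < k) x)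
      (chain t lam1 (Some (snd (pass b v hs1), kind_of b v hs1)) (fst (pass b v hs1)) (ls @ gs1)) =
    map_pmf (\<lambda>(x, us). filter (\<lambda>a. a < k) x)
      (chain t lam2 (Some (snd (pass b v hs2), kind_of b v hs2)) (fst (pass b v hs2)) (ls @ gs2))" for b
  proof (rule Cons.IH)
    show "filter (\<lambda>a. a < k) (fst (pass b v hs1)) = filter (\<lambda>a. a < k) (fst (pass b v hs2))"
      using pass_low(1) Cons.prems(5-7) by metis
    have "min k (snd (pass b v hs1)) = min k (snd (pass b v hs2))"
      using pass_low(2) Cons.prems(5-7) by metis
    then show "prev_low k (Some (snd (pass b v hs1), kind_of b v hs1)) =
        prev_low k (Some (snd (pass b v hs2), kind_of b v hs2))"
      using mem by (simp add: prev_low_def kind_of_def)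
  qed (use Cons.prems in \<open>auto intro: sorted_pass\<close>)
  ultimately show ?case by (simp add: map_bind_pmf *)
qed

section \<open>Rows of an admissible diagram\<close>

lemma moves_unique: "moves k \<kappa> \<kappa>' \<Longrightarrow> moves l \<kappa> \<kappa>' \<Longrightarrow> k = l"
  by (metis moves_def advance_def advance_inj)

lemma hpos_eq: "moves k (\<Lambda> (i, j)) (\<Lambda> (Suc i, j)) \<Longrightarrow> hpos \<Lambda> i j = k"
  unfolding hpos_def by (blast intro: the_equality moves_unique)

lemma vpos_eq: "moves k (\<Lambda> (i, j)) (\<Lambda> (i, Suc j)) \<Longrightarrow> vpos \<Lambda> i j = k"
  unfolding vpos_def by (blast intro: the_equality moves_unique)

lemma count_list_fold_advance:
  "movable \<kappa> ks \<Longrightarrow>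
    count_list (fold advance ks \<kappa>) x + count_list ks x = count_list \<kappa> x + count_list ks (x - 1)"
proof (induction ks arbitrary: \<kappa>)
  case (Cons k ks)
  then show ?case using Cons.IH[of "advance k \<kappa>"] count_list_advance[of k \<kappa> x] by auto
qed simp

text \<open>All equal-position boxes of a row have the same type, so the bit can be read off from
  whether the vertical line has moved at the end of the row. After a one-box the vertical line sits at
  the new position of some horizontal line to the left, and a zero-box there would
  give two horizontal lines the same new position. After a zero-box the vertical line stays at the
  position of a horizontal line and never meets the strictly larger ones further right.\<close>

lemma row_recursion:
  fixes h h' v :: "nat \<Rightarrow> int"
  assumes triv: "\<And>i. i < m \<Longrightarrow> h i \<noteq> v i \<Longrightarrow> h' i = h i \<and> v (Suc i) = v i"
    and coll: "\<And>i. i < m \<Longrightarrow> h i = v i \<Longrightarrow> h' i = v (Suc i) \<and> v (Suc i) \<in> {h i, h i + 1}"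
    and sh: "\<And>i i'. i < i' \<Longrightarrow> i' < m \<Longrightarrow> h i < h i'"
    and sh': "\<And>i i'. i < i' \<Longrightarrow> i' < m \<Longrightarrow> h' i < h' i'"
    and b: "v 0 \<in> h ` {..<m} \<Longrightarrow> b = (v m \<noteq> v 0)"
    and i: "i < m"
  shows "v (Suc i) = (if b \<and> h i = v i then v i + 1 else v i)"
    and "h' i = (if b \<and> h i = v i then h i + 1 else h i)"
proof -
  have mono1: "v p \<le> v (Suc p)" if "p < m" for p
    using triv[OF that] coll[OF that] by (cases "h p = v p") auto
  have mono: "v p \<le> v q" if "p \<le> q" "q \<le> m" for p q
    using that
  proof (induction q rule: dec_induct)
    case (step q)
    then show ?case using mono1[of q] by simp
  qed simp
  have push: "v (Suc q) = h q + 1" if "p < q" "q < m" "h p = v p" "v (Suc p) = h p + 1" "h q = v q" for p q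
  proof -
    have "\<exists>r<s. v s = h' r" if "p < s" "s \<le> m" for s
      using that
    proof (induction s)
      case (Suc s)
      show ?case
      proof (cases "h s = v s")
        case True
        then show ?thesis using coll[of s] Suc.prems by auto
      next
        case False
        then have "p < s" using Suc.prems \<open>h p = v p\<close> by (metis less_antisym)
        then obtain r where "r < s" "v s = h' r" using Suc by auto
        moreover have "v (Suc s) = v s" using triv False Suc.prems by simp
        ultimately show ?thesis by (metis less_SucI)
      qed
    qed simp
    then obtain r where "r < q" "v q = h' r" using \<open>p < q\<close> \<open>q < m\<close> by (meson less_imp_le)
    then have "h' q \<noteq> h q" using sh'[of r q] that by auto
    then show ?thesis using coll[of q] that by auto
  qed
  have const: "v m = v s" if s: "s \<le> m" and above: "\<And>q. s \<le> q \<Longrightarrow> q < m \<Longrightarrow> v s < h q" for s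
  proof -
    have "v q = v s" if "s \<le> q" "q \<le> m" for q
      using that
    proof (induction q rule: dec_induct)
      case (step q)
      then have "v s < h q" "v q = v s" using above by simp_all
      then show ?case using step.prems triv[of q] by auto
    qed simp
    from this[OF s] show ?thesis by simp
  qed
  have none: "h p \<noteq> v p" if nc: "v 0 \<notin> h ` {..<m}" and p: "p < m" for p
  proof -
    have "v q = v 0" if "q \<le> m" for q
      using that
    proof (induction q)
      case (Suc q)
      have "v q = v 0" using Suc.IH Suc.prems by simp
      moreover have "h q \<in> h ` {..<m}" using Suc.prems by (intro imageI) simp
      ultimately have "h q \<noteq> v q" using nc by metis
      then have "v (Suc q) = v q" using triv[of q] Suc.prems by simp
      then show ?case using \<open>v q = v 0\<close> by (rule trans)
    qed simp
    from this[of p] have "v p = v 0" using p by simp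
    moreover have "h p \<in> h ` {..<m}" using p by (intro imageI) simp
    ultimately show ?thesis using nc by metis
  qed
  have goal: "v (Suc i) = (if b then h i + 1 else h i)" if c: "h i = v i"
  proof -
    have b': "b = (v m \<noteq> v 0)" using none[OF _ i] c b by blast
    show ?thesis
    proof (cases "v m = v 0")
      case True
      have "v (Suc i) = v i" using mono[of 0 i] mono[of i "Suc i"] mono[of "Suc i" m] True i by simp
      then show ?thesis using b' True c by simp
    next
      case False
      have "v (Suc i) = h i + 1"
      proof (rule ccontr)
        assume "v (Suc i) \<noteq> h i + 1"
        then have stay: "v (Suc i) = h i" using coll[OF i c] by auto
        have "v m = v (Suc i)"
        proof (rule const)
          show "v (Suc i) < h q" if "Suc i \<le> q" "q < m" for q
            using sh[of i q] that stay by simp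
        qed (use i in simp)
        then have "v i \<noteq> v 0" using False stay c by simp
        moreover have "v i = v 0" if "\<forall>p<i. v (Suc p) = v p"
          using that by (induction i) auto
        ultimately obtain p where p: "p < i" "v (Suc p) \<noteq> v p" by blast
        then have "h p = v p" using triv[of p] i by auto
        moreover from this have "v (Suc p) = h p + 1" using coll[of p] i p by auto
        ultimately show False using push[OF p(1) i] c \<open>v (Suc i) \<noteq> h i + 1\<close> by blast
      qed
      then show ?thesis using False b' by simp
    qed
  qed
  show "v (Suc i) = (if b \<and> h i = v i then v i + 1 else v i)"
    using goal triv[OF i] by (cases "h i = v i") auto
  show "h' i = (if b \<and> h i = v i then h i + 1 else h i)"
    using goal triv[OF i] coll[OF i] by (cases "h i = v i") auto
qed

definition hrow :: "(nat \<times> nat \<Rightarrow> int list) \<Rightarrow> nat \<Rightarrow> nat \<Rightarrow> int list" where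
  "hrow \<Lambda> m j = map (\<lambda>i. hpos \<Lambda> i j) [0..<m]"

text \<open>In a row without an equal-position box the bit is \<open>True\<close>, in accordance with \<open>mode_pmf\<close>.\<close>

definition row_mode :: "(nat \<times> nat \<Rightarrow> int list) \<Rightarrow> nat \<Rightarrow> nat \<Rightarrow> bool" where
  "row_mode \<Lambda> m j \<longleftrightarrow> (vpos \<Lambda> 0 j \<in> set (hrow \<Lambda> m j) \<longrightarrow> vpos \<Lambda> m j \<noteq> vpos \<Lambda> 0 j)"

definition prev_row :: "(nat \<times> nat \<Rightarrow> int list) \<Rightarrow> nat \<Rightarrow> nat \<Rightarrow> (int \<times> row_kind) option" where
  "prev_row \<Lambda> m j = (if j = 0 then None
     else Some (vpos \<Lambda> m (j - 1), kind_of (row_mode \<Lambda> m (j - 1)) (vpos \<Lambda> 0 (j - 1)) (hrow \<Lambda> m (j - 1))))"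

text \<open>Admissibility with unspecified corners, so that a diagram can be built row by row.\<close>

locale grid =
  fixes N m n :: nat and \<Lambda> :: "nat \<times> nat \<Rightarrow> int list"
  assumes adm: "admissible N m n (\<Lambda> (0, n)) (\<Lambda> (m, n)) (\<Lambda> (0, 0)) (\<Lambda> (m, 0)) \<Lambda>"
begin

abbreviation "h \<equiv> hpos \<Lambda>"
abbreviation "v \<equiv> vpos \<Lambda>"
abbreviation "hs \<equiv> hrow \<Lambda> m"
abbreviation "mode \<equiv> row_mode \<Lambda> m"

lemma in_Sig: "i \<le> m \<Longrightarrow> j \<le> n \<Longrightarrow> \<Lambda> (i, j) \<in> Sig N"
  using adm unfolding admissible_def by auto

lemma h_moves:
  assumes "i < m" "j \<le> n"
  shows "h i j \<in> set (\<Lambda> (i, j))" "\<Lambda> (Suc i, j) = advance (h i j) (\<Lambda> (i, j))"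
proof -
  have "\<forall>i<m. \<forall>j\<le>n. \<exists>k. moves k (\<Lambda> (i, j)) (\<Lambda> (Suc i, j))"
    using adm unfolding admissible_def by (elim conjE)
  then obtain k where k: "moves k (\<Lambda> (i, j)) (\<Lambda> (Suc i, j))" using assms by blast
  then show "h i j \<in> set (\<Lambda> (i, j))" "\<Lambda> (Suc i, j) = advance (h i j) (\<Lambda> (i, j))"
    using moves_iff_advance[OF in_Sig[of "Suc i" j]] assms hpos_eq[OF k] by auto
qed

lemma v_moves:
  assumes "i \<le> m" "j < n"
  shows "v i j \<in> set (\<Lambda> (i, j))" "\<Lambda> (i, Suc j) = advance (v i j) (\<Lambda> (i, j))"
proof -
  have "\<forall>i\<le>m. \<forall>j<n. \<exists>k. moves k (\<Lambda> (i, j)) (\<Lambda> (i, Suc j))"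
    using adm unfolding admissible_def by (elim conjE)
  then obtain k where k: "moves k (\<Lambda> (i, j)) (\<Lambda> (i, Suc j))" using assms by blast
  then show "v i j \<in> set (\<Lambda> (i, j))" "\<Lambda> (i, Suc j) = advance (v i j) (\<Lambda> (i, j))"
    using moves_iff_advance[OF in_Sig[of i "Suc j"]] assms vpos_eq[OF k] by auto
qed

lemma h_less: "i < i' \<Longrightarrow> i' < m \<Longrightarrow> j \<le> n \<Longrightarrow> h i j < h i' j"
proof (induction i i' rule: less_Suc_induct)
  case (1 i)
  have "\<forall>i j. Suc i < m \<and> j \<le> n \<longrightarrow> h i j < h (Suc i) j"
    using adm unfolding admissible_def by (elim conjE)
  then show ?case using 1 by simp
qed simp

lemma v_less: "j < j' \<Longrightarrow> j' < n \<Longrightarrow> i \<le> m \<Longrightarrow> v i j < v i j'"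
proof (induction j j' rule: less_Suc_induct)
  case (1 j)
  have "\<forall>i j. i \<le> m \<and> Suc j < n \<longrightarrow> v i j < v i (Suc j)"
    using adm unfolding admissible_def by (elim conjE)
  then show ?case using 1 by simp
qed simp

lemma h_less_iff: "i < m \<Longrightarrow> i' < m \<Longrightarrow> j \<le> n \<Longrightarrow> h i j < h i' j \<longleftrightarrow> i < i'"
  using h_less[of i i' j] h_less[of i' i j] by (cases i i' rule: linorder_cases) auto

text \<open>In an increasing row, adjacent positions belong to adjacent lines.\<close>

lemma h_pred:
  assumes "p < m" "i < m" "j \<le> n" "h i j = h p j + 1"
  shows "0 < i" "p = i - 1"
proof -
  have "p < i" using h_less_iff[of p i j] assms by simp
  then show "0 < i" by simp
  have "\<not> p < i - 1"
    using h_less[of p "i - 1" j] h_less[of "i - 1" i j] \<open>p < i\<close> assms by linarith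
  then show "p = i - 1" using \<open>p < i\<close> by simp
qed

text \<open>The two ways around a box lead from \<open>\<Lambda> (i, j)\<close> to \<open>\<Lambda> (i + 1, j + 1)\<close>, hence
  move particles from the same two places.\<close>

lemma square:
  assumes "i < m" "j < n" "h i j \<noteq> v i j"
  shows "h i (Suc j) = h i j" "v (Suc i) j = v i j"
proof -
  have "of_bool (a = h i j + 1) + of_bool (a = v (Suc i) j + 1)
      = of_bool (a = v i j + 1) + (of_bool (a = h i (Suc j) + 1) :: nat)" for a
    using conj_part_advance[OF h_moves(1)[of i j], of a] conj_part_advance[OF v_moves(1)[of "Suc i" j], of a]
      conj_part_advance[OF v_moves(1)[of i j], of a] conj_part_advance[OF h_moves(1)[of i "Suc j"], of a]
      h_moves(2)[of i j] v_moves(2)[of "Suc i" j] v_moves(2)[of i j] h_moves(2)[of i "Suc j"]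
      assms by simp
  from this[of "h i j + 1"] this[of "v i j + 1"] assms(3)
  show "h i (Suc j) = h i j" "v (Suc i) j = v i j"
    by (auto simp: of_bool_def split: if_splits)
qed

lemma collision:
  assumes "i < m" "j < n" "h i j = v i j"
  shows "h i (Suc j) = v (Suc i) j" "v (Suc i) j \<in> {h i j, h i j + 1}"
proof -
  have "\<forall>i<m. \<forall>j<n. h i j = v i j \<longrightarrow> h i (Suc j) = v (Suc i) j \<and> v (Suc i) j \<in> {h i j, h i j + 1}"
    using adm unfolding admissible_def by (elim conjE)
  then show "h i (Suc j) = v (Suc i) j" "v (Suc i) j \<in> {h i j, h i j + 1}" using assms by simp_all
qed

lemma set_hs: "set (hs j) = (\<lambda>i. h i j) ` {..<m}"
  by (auto simp: hrow_def)

lemma not_in_hs: "x \<notin> set (hs j) \<Longrightarrow> i < m \<Longrightarrow> h i j \<noteq> x"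
  by (auto simp: set_hs)

lemma length_hs [simp]: "length (hs j) = m"
  by (simp add: hrow_def)

lemma sorted_hs: "j \<le> n \<Longrightarrow> sorted_wrt (<) (hs j)"
  by (auto simp: hrow_def sorted_wrt_iff_nth_less h_less)

lemma step:
  assumes "i < m" "j < n"
  shows "v (Suc i) j = (if mode j \<and> h i j = v i j then v i j + 1 else v i j)"
    and "h i (Suc j) = (if mode j \<and> h i j = v i j then h i j + 1 else h i j)"
proof -
  have 1: "v 0 j \<in> (\<lambda>i. h i j) ` {..<m} \<Longrightarrow> mode j = (v m j \<noteq> v 0 j)"
    by (simp add: row_mode_def set_hs)
  have "Suc j \<le> n" "j \<le> n" using assms by auto
  note row = row_recursion[of m "\<lambda>i. h i j" "\<lambda>i. v i j" "\<lambda>i. h i (Suc j)" "mode j",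
      OF _ _ h_less h_less 1 assms(1)]
  show "v (Suc i) j = (if mode j \<and> h i j = v i j then v i j + 1 else v i j)"
    "h i (Suc j) = (if mode j \<and> h i j = v i j then h i j + 1 else h i j)"
    by (rule row; use assms square collision in auto)+
qed

lemma pass_hs: "j < n \<Longrightarrow> pass (mode j) (v 0 j) (hs j) = (hs (Suc j), v m j)"
  unfolding hrow_def by (rule pass_eq_rec) (auto simp: step)

lemma v_mono: "i \<le> i' \<Longrightarrow> i' \<le> m \<Longrightarrow> j < n \<Longrightarrow> v i j \<le> v i' j"
proof (induction i' rule: dec_induct)
  case (step i')
  then show ?case using \<open>j < n\<close> grid.step(1)[OF grid_axioms, of i' j] by simp
qed simp

lemma v_const:
  assumes "i \<le> i'" "i' \<le> m" "j < n" "\<And>q. i \<le> q \<Longrightarrow> q < i' \<Longrightarrow> mode j \<Longrightarrow> h q j \<noteq> v i j"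
  shows "v i' j = v i j"
  using assms
proof (induction i' rule: dec_induct)
  case (step i')
  then show ?case using grid.step(1)[OF grid_axioms, of i' j] by simp
qed simp

lemma no_collision:
  assumes "j < n" "v 0 j \<notin> set (hs j)" "i \<le> m"
  shows "v i j = v 0 j"
    by (rule v_const) (use assms not_in_hs[OF assms(2)] in auto)

text \<open>A displaced vertical line was last displaced at a one-box, which left a horizontal line at the
  same position.\<close>

lemma last_push:
  assumes "i \<le> m" "j < n" "v i j \<noteq> v 0 j"
  obtains q where "q < i" "mode j" "h q j = v q j" "v i j = h q j + 1" "v (Suc q) j = v i j"
proof -
  have "\<exists>q<i. mode j \<and> h q j = v q j \<and> v i j = h q j + 1 \<and> v (Suc q) j = v i j"
    using assms
  proof (induction i)
    case (Suc i)
    show ?case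
    proof (cases "mode j \<and> h i j = v i j")
      case True
      then show ?thesis using step(1)[of i j] Suc.prems by auto
    next
      case False
      then have "v (Suc i) j = v i j" using step(1)[of i j] Suc.prems by auto
      then show ?thesis using Suc by (metis Suc_leD less_SucI)
    qed
  qed simp
  then show ?thesis using that by blast
qed

lemma column_fold:
  "j \<le> n \<Longrightarrow> i \<le> m \<Longrightarrow> movable (\<Lambda> (i, 0)) (map (v i) [0..<j]) \<and> fold advance (map (v i) [0..<j]) (\<Lambda> (i, 0)) = \<Lambda> (i, j)"
  by (induction j) (auto simp: movable_append v_moves)

lemma row_fold:
  "i \<le> m \<Longrightarrow> j \<le> n \<Longrightarrow> movable (\<Lambda> (0, j)) (map (\<lambda>i. h i j) [0..<i]) \<and>
    fold advance (map (\<lambda>i. h i j) [0..<i]) (\<Lambda> (0, j)) = \<Lambda> (i, j)"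
  by (induction i) (auto simp: movable_append h_moves)

text \<open>If no line passes from \<open>r - 1\<close> to \<open>r\<close>, the multiplicity at \<open>r\<close> that enters
  rules (4) and (5) is still the one in \<open>\<lambda>\<close>.\<close>

lemma count_far:
  assumes "i < m" "j \<le> n" "\<And>j'. j' < j \<Longrightarrow> v 0 j' < h i j - 1" "h i j - 1 \<notin> set (hs j)"
  shows "count_list (\<Lambda> (i, j)) (h i j) = count_list (\<Lambda> (0, 0)) (h i j)"
proof -
  have "h i' j \<noteq> h i j - 1" if "i' < i" for i'
    using not_in_hs[OF assms(4)] that assms(1) by simp
  moreover have "h i' j < h i j" if "i' < i" for i'
    using h_less[OF that assms(1,2)] .
  ultimately have "count_list (map (\<lambda>i. h i j) [0..<i]) (h i j) = 0"
    "count_list (map (\<lambda>i. h i j) [0..<i]) (h i j - 1) = 0"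
    unfolding count_list_0_iff by fastforce+
  then have "count_list (\<Lambda> (i, j)) (h i j) = count_list (\<Lambda> (0, j)) (h i j)"
    using count_list_fold_advance[of "\<Lambda> (0, j)" "map (\<lambda>i. h i j) [0..<i]" "h i j"] row_fold[of i j] assms by simp
  moreover have "count_list (map (v 0) [0..<j]) (h i j) = 0"
    "count_list (map (v 0) [0..<j]) (h i j - 1) = 0"
    using assms(3) by (force simp: count_list_0_iff)+
  then have "count_list (\<Lambda> (0, j)) (h i j) = count_list (\<Lambda> (0, 0)) (h i j)"
    using count_list_fold_advance[of "\<Lambda> (0, 0)" "map (v 0) [0..<j]" "h i j"] column_fold[of j 0] assms by simp
  ultimately show ?thesis by simp
qed

lemma one_box_iff: "i < m \<Longrightarrow> j < n \<Longrightarrow> one_box \<Lambda> i j \<longleftrightarrow> mode j \<and> h i j = v i j"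
  using step[of i j] by (auto simp: one_box_def)

lemma zero_box_iff: "i < m \<Longrightarrow> j < n \<Longrightarrow> zero_box \<Lambda> i j \<longleftrightarrow> \<not> mode j \<and> h i j = v i j"
  using step[of i j] by (auto simp: zero_box_def)

section \<open>The weight of a row\<close>

text \<open>Any later equal-position box of the row is met by the vertical line right after
  a one-box: the positions of consecutive such lines differ by one, so the lines are neighbours. Hence it
  is a one-box with a one-box to its left and has weight one.\<close>

lemma row_weight_first:
  assumes "i0 < m" "j < n" "h i0 j = v 0 j"
  shows "(\<Prod>i<m. box_weight t \<Lambda> i j) = box_weight t \<Lambda> i0 j"
proof -
  have "box_weight t \<Lambda> i j = 1" if i: "i < m" "i \<noteq> i0" for i
  proof (cases "h i j = v i j")
    case False
    then show ?thesis using i assms by (simp add: box_weight_def Let_def zero_box_iff one_box_iff)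
  next
    case True
    have "v 0 j \<le> v i j" using v_mono i assms by simp
    then have "i0 < i" using h_less_iff[of i i0 j] True i assms by (metis linorder_less_linear not_le order_less_imp_le)
    then have "v i j \<noteq> v 0 j" using h_less[of i0 i j] True i assms by simp
    then obtain q where q: "q < i" "mode j" "h q j = v q j" "v i j = h q j + 1"
      using last_push[of i j] i assms by auto
    then have "0 < i" "q = i - 1" using h_pred[of q i j] True i assms by auto
    then have "one_box \<Lambda> i j" "one_box \<Lambda> (i - 1) j" using q i assms True by (simp_all add: one_box_iff)
    then show ?thesis using \<open>0 < i\<close> by (simp add: box_weight_def Let_def)
  qed
  then have "(\<Prod>i\<in>{..<m} - {i0}. box_weight t \<Lambda> i j) = 1" by (intro prod.neutral) auto
  then show ?thesis using assms prod.remove[of "{..<m}" i0 "\<lambda>i. box_weight t \<Lambda> i j"] by simp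
qed

text \<open>The case distinction of \<open>push_prob\<close> decides which of the six rules applies to the
  first equal-position box of row \<open>j\<close>. It only involves the preceding row: the vertical line
  of that row below the box, and the type of the diagonal neighbour, can be recovered
  from its exit position and its kind.\<close>

lemma row_weight:
  assumes t: "0 \<le> t" "t < 1" and j: "j < n"
  shows "(\<Prod>i<m. box_weight t \<Lambda> i j) =
    pmf (mode_pmf t (\<Lambda> (0, 0)) (prev_row \<Lambda> m j) (hs j) (v 0 j)) (mode j)"
proof (cases "v 0 j \<in> set (hs j)")
  case False
  have "box_weight t \<Lambda> i j = 1" if i: "i < m" for i
  proof -
    have "h i j \<noteq> v i j" using no_collision[OF j False, of i] i not_in_hs[OF False] by simp
    then show ?thesis using i j by (simp add: box_weight_def Let_def zero_box_iff one_box_iff)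
  qed
  moreover have "mode j" using False by (simp add: row_mode_def)
  ultimately show ?thesis using False by (simp add: mode_pmf_def)
next
  case True
  define r where "r = v 0 j"
  obtain i0 where i0: "i0 < m" "h i0 j = r" using True by (auto simp: set_hs r_def)
  have v_i0: "v i j = r" if "i \<le> i0" for i
  proof -
    have "h q j \<noteq> r" if "q < i" for q using h_less[of q i0 j] that \<open>i \<le> i0\<close> i0 j by simp
    then show ?thesis using v_const[of 0 i j] i0 j \<open>i \<le> i0\<close> by (simp add: r_def)
  qed
  define c where "c = t ^ count_list (\<Lambda> (i0, j)) r"
  have "0 < count_list (\<Lambda> (i0, j)) r"
    using h_moves(1)[of i0 j] i0 j by (metis count_list_0_iff gr0I less_imp_le)
  then have c: "c < 1" using t by (simp add: c_def power_Suc_less_one power_less_one_iff)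
  define oneD where "oneD \<longleftrightarrow> 0 < j \<and> one_box \<Lambda> i0 (j - 1)"
  define trivD where "trivD \<longleftrightarrow> \<not> (0 < j \<and> (zero_box \<Lambda> i0 (j - 1) \<or> one_box \<Lambda> i0 (j - 1)))"
  define zD where "zD \<longleftrightarrow> 0 < i0 \<and> 0 < j \<and> zero_box \<Lambda> (i0 - 1) (j - 1) \<and> h (i0 - 1) j = r - 1"
  define oD where "oD \<longleftrightarrow> 0 < i0 \<and> 0 < j \<and> one_box \<Lambda> (i0 - 1) (j - 1) \<and> h (i0 - 1) j = r - 1"
  define hL where "hL \<longleftrightarrow> 0 < i0 \<and> h (i0 - 1) j = r - 1"
  define vD where "vD \<longleftrightarrow> 0 < j \<and> v i0 (j - 1) = r - 1"
  define far where "far \<longleftrightarrow> (0 < i0 \<longrightarrow> h (i0 - 1) j < r - 1) \<and> (0 < j \<longrightarrow> v i0 (j - 1) < r - 1)"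
  have left: "\<not> (0 < i0 \<and> zero_box \<Lambda> (i0 - 1) j)" "\<not> (0 < i0 \<and> one_box \<Lambda> (i0 - 1) j)"
    using v_i0[of "i0 - 1"] h_less[of "i0 - 1" i0 j] i0 j by (auto simp: zero_box_def one_box_def)
  have boxes: "zero_box \<Lambda> i0 j \<longleftrightarrow> \<not> mode j" "one_box \<Lambda> i0 j \<longleftrightarrow> mode j"
    using v_i0[of i0] i0 j by (simp_all add: zero_box_iff one_box_iff)
  have W: "(\<Prod>i<m. box_weight t \<Lambda> i j) =
    (if mode j then
       (if oneD \<or> oD then 1 else if trivD \<and> hL \<noteq> vD then 1 - t
        else if far then (1 - t) / (1 - c) else if zD then 0 else undefined)
     else (if zD then 1 else if hL \<noteq> vD then t else if far then (t - c) / (1 - c)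
        else if oD then 0 else undefined))"
    unfolding row_weight_first[OF i0(1) j i0(2)[unfolded r_def]]
    unfolding box_weight_def Let_def i0(2) boxes
    unfolding oneD_def[symmetric] trivD_def[symmetric] zD_def[symmetric] oD_def[symmetric]
      hL_def[symmetric] vD_def[symmetric] far_def[symmetric] c_def[symmetric]
    using left by auto
  have hL_iff: "hL \<longleftrightarrow> r - 1 \<in> set (hs j)"
  proof
    assume "r - 1 \<in> set (hs j)"
    then obtain p where p: "p < m" "h p j = r - 1" by (auto simp: set_hs)
    then show hL using h_pred[of p i0 j] i0 j by (auto simp: hL_def)
  next
    assume hL
    then show "r - 1 \<in> set (hs j)" using i0 unfolding hL_def set_hs
      by (intro image_eqI[of _ _ "i0 - 1"]) auto
  qed
  have hless: "0 < i0 \<Longrightarrow> h (i0 - 1) j < r" using h_less[of "i0 - 1" i0 j] i0 j by simp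
  have P: "(\<Prod>i<m. box_weight t \<Lambda> i j) = (if mode j then p else 1 - p)"
    if p: "p = push_prob t (\<Lambda> (0, 0)) (prev_row \<Lambda> m j) (hs j) r" for p
  \<comment> \<open>In the first case the vertical line of the preceding row stays below \<open>r - 1\<close>, and rules
    (2) to (5) apply, depending on \<open>hL\<close>. Otherwise the kind of the preceding row decides.\<close>
  proof (cases "0 < j \<longrightarrow> v m (j - 1) < r - 1")
    case True
    have vl: "v i (j - 1) < r - 1" if "0 < j" "i \<le> m" for i
    proof -
      have "j - 1 < n" using j by simp
      then show ?thesis using v_mono[of i m "j - 1"] True that by force
    qed
    have "\<not> vD" using vl[of i0] i0 by (auto simp: vD_def)
    moreover have trivD
      using vl[of "Suc i0"] i0 by (auto simp: trivD_def zero_box_def one_box_def dest!: gr0_implies_Suc)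
    moreover have "\<not> oneD" using \<open>trivD\<close> by (auto simp: trivD_def oneD_def)
    moreover have "\<not> zD" "\<not> oD"
      using vl[of i0] i0 by (auto simp: zD_def oD_def zero_box_def one_box_def dest!: gr0_implies_Suc)
    moreover have "far \<longleftrightarrow> \<not> hL" using hless vl[of i0] i0 by (auto simp: far_def hL_def)
    moreover have "p = base_prob t (\<Lambda> (0, 0)) (hs j) r"
      using True by (auto simp: p prev_row_def)
    moreover have "c = t ^ count_list (\<Lambda> (0, 0)) r" if "\<not> hL"
    proof -
      have "v 0 j' < r - 1" if "j' < j" for j'
      proof (cases "j' = j - 1")
        case True
        then show ?thesis using vl[of 0] that by simp
      next
        case False
        then have "j' < j - 1" "j - 1 < n" using that j by linarith+
        then have "v 0 j' < v 0 (j - 1)" using v_less by blast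
        then show ?thesis using vl[of 0] that by simp
      qed
      then show ?thesis using count_far[of i0 j] i0 j that hL_iff by (simp add: c_def)
    qed
    ultimately show ?thesis using W c hL_iff by (auto simp: base_prob_def field_simps)
  next
    case False
    then obtain j' where j': "j = Suc j'" "r \<le> v m j' + 1" by (cases j) auto
    have j'n: "j' < n" using j' j by simp
    have rv: "v 0 j' < r" using v_less[of j' j 0] j j' by (simp add: r_def)
    let ?k = "kind_of (mode j') (v 0 j') (hs j')"
    have pk: "p = (case ?k of Free \<Rightarrow> 1 - t | Stay \<Rightarrow> 0 | Push \<Rightarrow> 1)"
      using j' by (simp add: p prev_row_def)
    show ?thesis
    proof (cases ?k)
      case Free
      then have nc: "v 0 j' \<notin> set (hs j')" by (simp add: kind_of_def split: if_splits)
      have vc: "v i j' = v 0 j'" if "i \<le> m" for i using no_collision[OF j'n nc that] .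
      have "hs j = hs j'" using pass_hs[OF j'n] pass_disjoint[OF nc] j' by simp
      moreover have r: "r = v 0 j' + 1" using rv j' vc[of m] by simp
      ultimately have "\<not> hL" using nc hL_iff by simp
      moreover have "vD" using r vc[of i0] i0 j' by (simp add: vD_def)
      moreover have "\<not> zero_box \<Lambda> i j'" "\<not> one_box \<Lambda> i j'" if "i < m" for i
        using vc[of i] not_in_hs[OF nc, of i] that by (auto simp: zero_box_def one_box_def)
      then have "trivD" "\<not> oneD" "\<not> oD" "\<not> zD" using i0 j' by (auto simp: trivD_def oneD_def oD_def zD_def)
      ultimately show ?thesis using W pk Free by simp
    next
      case Stay
      then have col: "v 0 j' \<in> set (hs j')" and md: "\<not> mode j'"
        by (auto simp: kind_of_def split: if_splits)
      have vc: "v i j' = v 0 j'" if "i \<le> m" for i using v_const[of 0 i j'] that md j'n by simp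
      have hc: "h i j = h i j'" if "i < m" for i using step(2)[of i j'] that md j'n j' by simp
      have r: "r = v 0 j' + 1" using rv j' vc[of m] by simp
      obtain q where q: "q < m" "h q j' = v 0 j'" using col by (auto simp: set_hs)
      then have q': "0 < i0" "q = i0 - 1" using h_pred[of q i0 j] i0 hc[of q] r j by auto
      have zD using q q' r hc[of q] vc[of q] md i0 j'n j' by (simp add: zD_def zero_box_iff)
      moreover have "\<not> oneD" "\<not> oD" using md i0 j' j'n by (auto simp: oneD_def oD_def one_box_iff)
      moreover have hL using \<open>zD\<close> by (auto simp: zD_def hL_def)
      moreover have vD using vc[of i0] i0 r j' by (simp add: vD_def)
      moreover have "\<not> far" using \<open>vD\<close> by (auto simp: vD_def far_def)
      ultimately show ?thesis using W pk Stay by simp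
    next
      case Push
      then have col: "v 0 j' \<in> set (hs j')" and md: "mode j'"
        by (auto simp: kind_of_def split: if_splits)
      have p1: "p = 1" using pk Push by simp
      show ?thesis
      \<comment> \<open>The line \<open>h i0\<close> was either pushed from \<open>r - 1\<close> in the preceding row, or it
          was not touched; then the last one-box of that row is the diagonal neighbour.\<close>
      proof (cases oneD)
        case True
        have "mode j"
        proof (rule ccontr)
          assume "\<not> mode j"
          then have "v m j = r" using v_const[of 0 m j] j by (simp add: r_def)
          moreover have "v m j' < v m j" using v_less[of j' j m] j j' by simp
          moreover have "v (Suc i0) j' = r" using True i0 j' by (simp add: oneD_def one_box_def)
          moreover have "v (Suc i0) j' \<le> v m j'" using v_mono[of "Suc i0" m j'] i0 j'n by simp
          ultimately show False by simp
        qed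
        then show ?thesis using W p1 True by simp
      next
        case False
        then have nb: "\<not> (h i0 j' = v i0 j')" using md i0 j' j'n by (simp add: oneD_def one_box_iff)
        then have h0: "h i0 j' = r" using step(2)[of i0 j'] i0 j'n j' by simp
        obtain q0 where q0: "q0 < m" "h q0 j' = v 0 j'" using col by (auto simp: set_hs)
        have "q0 < i0" using h_less_iff[of q0 i0 j'] q0 i0 h0 rv j'n by simp
        moreover have "v q0 j' = v 0 j'"
        proof (rule v_const)
          show "h q j' \<noteq> v 0 j'" if "q < q0" for q using h_less[of q q0 j'] that q0 j'n by simp
        qed (use q0 j'n in auto)
        then have "v (Suc q0) j' = v 0 j' + 1" using step(1)[of q0 j'] q0 md j'n by simp
        ultimately have "v i0 j' \<noteq> v 0 j'" using v_mono[of "Suc q0" i0 j'] i0 j'n by simp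
        then obtain q where q: "q < i0" "h q j' = v q j'" "v i0 j' = h q j' + 1"
          using last_push[of i0 j'] i0 j'n by auto
        then have hq: "h q j = v i0 j'" using step(2)[of q j'] i0 j'n j' md by simp
        then have lt: "v i0 j' < r" using h_less[of q i0 j] q i0 j by simp
        have "v m j' = v i0 j'"
        proof (rule v_const)
          show "h p j' \<noteq> v i0 j'" if "i0 \<le> p" "p < m" for p
            using h_less[of i0 p j'] that h0 lt j'n by (cases "p = i0") auto
        qed (use i0 j'n in auto)
        then have r: "v i0 j' = r - 1" using lt j' by simp
        then have q': "0 < i0" "q = i0 - 1" using h_pred[of q i0 j] hq i0 j q by auto
        have "one_box \<Lambda> q j'" using one_box_iff[of q j'] q i0 j'n md by simp
        then have oD using q' r hq j' by (simp add: oD_def)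
        moreover have "\<not> zD" using md i0 j' j'n by (simp add: zD_def zero_box_iff)
        moreover have hL using \<open>oD\<close> by (auto simp: oD_def hL_def)
        moreover have vD using r j' by (simp add: vD_def)
        moreover have "\<not> far" using \<open>vD\<close> by (auto simp: vD_def far_def)
        ultimately show ?thesis using W p1 by simp
      qed
    qed
  qed
  show ?thesis
    using True P[OF refl] push_prob_bounds[OF t, of "\<Lambda> (0, 0)" "prev_row \<Lambda> m j" "hs j" r]
    by (simp add: mode_pmf_def r_def)
qed

lemma prev_row_Suc:
  "prev_row \<Lambda> m (Suc j) = Some (v m j, kind_of (mode j) (v 0 j) (hs j))"
  by (simp add: prev_row_def)

text \<open>Induction from the last row downwards: \<open>row_weight\<close> supplies the factor that
  \<open>pmf_chain_Cons\<close> splits off for each row.\<close>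

lemma diagram_weight:
  assumes t: "0 \<le> t" "t < 1"
  shows "(\<Prod>i<m. \<Prod>j<n. box_weight t \<Lambda> i j) =
    pmf (chain t (\<Lambda> (0, 0)) None (hs 0) (map (v 0) [0..<n])) (hs n, map (v m) [0..<n])"
proof -
  have "(\<Prod>j\<in>{j..<n}. \<Prod>i<m. box_weight t \<Lambda> i j) =
    pmf (chain t (\<Lambda> (0, 0)) (prev_row \<Lambda> m j) (hs j) (map (v 0) [j..<n])) (hs n, map (v m) [j..<n])"
    if "j \<le> n" for j
    using that
  proof (induction j rule: inc_induct)
    case base
    then show ?case by simp
  next
    case (step j)
    have u: "snd (pass (mode j) (v 0 j) (hs j)) = v m j" "fst (pass (mode j) (v 0 j) (hs j)) = hs (Suc j)"
      using pass_hs[of j] step.hyps by auto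
    have "v 0 j \<notin> set (hs j) \<Longrightarrow> mode j" by (simp add: row_mode_def)
    then show ?case
      using step u by (simp add: upt_conv_Cons prod.atLeast_Suc_lessThan row_weight[OF t]
          pmf_chain_Cons[OF u(1)] prev_row_Suc del: chain.simps)
  qed
  from this[of 0] show ?thesis
    by (subst prod.swap) (simp add: prev_row_def lessThan_atLeast0)
qed

end

section \<open>Every outcome of the random insertion is a diagram\<close>

lemma advance_commute:
  assumes "k \<in> set \<kappa>" "l \<in> set \<kappa>" "k \<noteq> l"
  shows "advance k (advance l \<kappa>) = advance l (advance k \<kappa>)"
proof -
  obtain M' where M': "mset \<kappa> = add_mset k M'" using assms(1) by (metis insert_DiffM set_mset_mset)
  have "l \<in># mset \<kappa>" using assms(2) by simp
  then have "l \<in># M'" unfolding M' using assms(3) by simp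
  then obtain M where M: "mset \<kappa> = add_mset k (add_mset l M)" using M' by (metis insert_DiffM)
  have "mset \<kappa> - {#l#} + {#l + 1#} - {#k#} + {#k + 1#} = mset \<kappa> - {#k#} + {#k + 1#} - {#l#} + {#l + 1#}"
    unfolding M using assms(3) by (simp add: add_mset_commute)
  then show ?thesis by (simp only: advance_def[of k "advance l \<kappa>"] advance_def[of l "advance k \<kappa>"] mset_advance)
qed

text \<open>The positions are supplied as functions, which relieves the user of the descriptions in \<open>hpos\<close> and \<open>vpos\<close>.\<close>

lemma admissibleI:
  fixes hf vf :: "nat \<Rightarrow> nat \<Rightarrow> int"
  assumes "\<Lambda> \<in> ({0..m} \<times> {0..n}) \<rightarrow>\<^sub>E Sig N"
    and H: "\<And>i j. i < m \<Longrightarrow> j \<le> n \<Longrightarrow> moves (hf i j) (\<Lambda> (i, j)) (\<Lambda> (Suc i, j))"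
    and V: "\<And>i j. i \<le> m \<Longrightarrow> j < n \<Longrightarrow> moves (vf i j) (\<Lambda> (i, j)) (\<Lambda> (i, Suc j))"
    and "\<And>i j. Suc i < m \<Longrightarrow> j \<le> n \<Longrightarrow> hf i j < hf (Suc i) j"
    and "\<And>i j. i \<le> m \<Longrightarrow> Suc j < n \<Longrightarrow> vf i j < vf i (Suc j)"
    and "\<And>i j. i < m \<Longrightarrow> j < n \<Longrightarrow> hf i j = vf i j \<Longrightarrow>
      hf i (Suc j) = vf (Suc i) j \<and> vf (Suc i) j \<in> {hf i j, hf i j + 1}"
  shows "grid N m n \<Lambda>"
proof -
  have h: "hpos \<Lambda> i j = hf i j" if "i < m" "j \<le> n" for i j using hpos_eq[OF H[OF that]] .
  have v: "vpos \<Lambda> i j = vf i j" if "i \<le> m" "j < n" for i j using vpos_eq[OF V[OF that]] .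
  have "\<exists>k. moves k (\<Lambda> (i, j)) (\<Lambda> (Suc i, j))" if "i < m" "j \<le> n" for i j using H[OF that] by blast
  moreover have "\<exists>k. moves k (\<Lambda> (i, j)) (\<Lambda> (i, Suc j))" if "i \<le> m" "j < n" for i j using V[OF that] by blast
  ultimately show ?thesis
    unfolding grid_def admissible_def using assms(1,4-6) by (auto simp: h v)
qed

context grid
begin

text \<open>A zero-box moves two particles from the same place, so two have to be there. Whenever a zero-box has
  positive probability, one of the lines next to it has just brought a second particle to \<open>w\<close>,
  or \<open>\<lambda>\<close> itself has two, since otherwise rule (4) gives the weight zero.\<close>

lemma count_stay:
  assumes t: "0 \<le> t" "t < 1"
    and w: "w \<in> set (\<Lambda> (0, n))" "\<And>j. Suc j = n \<Longrightarrow> v 0 j < w"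
    and i: "i < m" "h i n = w"
    and p: "push_prob t (\<Lambda> (0, 0)) (prev_row \<Lambda> m n) (hs n) w \<noteq> 1"
  shows "2 \<le> count_list (\<Lambda> (i, n)) w"
proof (cases "0 < n \<and> w \<le> v m (n - 1) + 1")
  case True
  then obtain n' where n': "n = Suc n'" "w \<le> v m n' + 1" by (cases n) auto
  have "kind_of (mode n') (v 0 n') (hs n') \<noteq> Push"
    using p n' by (auto simp: prev_row_def)
  then have nc: "\<not> (mode n' \<and> v 0 n' \<in> set (hs n'))" by (auto simp: kind_of_def)
  have vc: "v q n' = v 0 n'" if "q \<le> m" for q
    using no_collision[of n' q] v_const[of 0 q n'] nc n' that by blast
  have "v i n' = w - 1" using vc[of i] vc[of m] w(2)[of n'] n' i by simp
  moreover have "\<not> (mode n' \<and> h i n' = v i n')"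
    using nc vc[of i] not_in_hs[of "v 0 n'" n' i] i by auto
  then have "h i n' = w" using step(2)[of i n'] n' i by auto
  then have "w \<in> set (\<Lambda> (i, n'))" using h_moves(1)[of i n'] n' i by simp
  then have "0 < count_list (\<Lambda> (i, n')) w" by (metis count_list_0_iff gr0I)
  ultimately show ?thesis
    using v_moves[of i n'] n' i count_list_advance[of "w - 1" "\<Lambda> (i, n')" w] by simp
next
  case False
  then have p': "base_prob t (\<Lambda> (0, 0)) (hs n) w \<noteq> 1"
    using p by (cases "n = 0") (auto simp: prev_row_def)
  show ?thesis
  proof (cases "w - 1 \<in> set (hs n)")
    case True
    then obtain q where q: "q < m" "h q n = w - 1" by (auto simp: set_hs)
    then have "q < i" "i = Suc q" using h_pred[of q i n] i by auto
    have "count_list (map (\<lambda>i. h i n) [0..<q]) w = 0"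
      unfolding count_list_0_iff using h_less[of _ q n] q by fastforce
    then have "count_list (\<Lambda> (0, n)) w \<le> count_list (\<Lambda> (q, n)) w"
      using count_list_fold_advance[of "\<Lambda> (0, n)" "map (\<lambda>i. h i n) [0..<q]" w] row_fold[of q n] q by simp
    moreover have "0 < count_list (\<Lambda> (0, n)) w" using w(1) by (metis count_list_0_iff gr0I)
    ultimately show ?thesis
      using h_moves[of q n] q \<open>i = Suc q\<close> count_list_advance[of "w - 1" "\<Lambda> (q, n)" w] by simp
  next
    case nL: False
    have "v 0 j < w - 1" if jn: "j < n" for j
    proof -
      obtain n' where n': "n = Suc n'" using jn by (cases n) auto
      have "v 0 n' < w - 1" using False n' v_mono[of 0 m n'] by simp
      then show ?thesis using v_less[of j n' 0] that n' by (cases "j = n'") auto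
    qed
    then have "count_list (\<Lambda> (i, n)) w = count_list (\<Lambda> (0, 0)) w"
      using count_far[of i n] i nL by simp
    moreover have "count_list (\<Lambda> (i, n)) w \<noteq> 0"
      using h_moves(1)[of i n] i by (simp add: count_list_0_iff)
    moreover have "count_list (\<Lambda> (0, 0)) w \<noteq> 1"
      using p' nL t by (auto simp: base_prob_def)
    ultimately show ?thesis by simp
  qed
qed

text \<open>Adding a row above the last one. The new row of signatures is forced; the points to check are that
  the moves exist (\<open>count_stay\<close>), that the horizontal positions stay increasing (\<open>sorted_pass\<close>), and that
  in each column the new vertical position exceeds the one below. If the line is pushed, the latter
  propagates along the row: when the lower line gains one, the horizontal line between them
  gains one as well and pushes the upper line should the two be level. If it is not pushed, it would
  be violated only after a row with one-boxes and for \<open>w\<close> not above their exit position,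
  a choice of probability zero.\<close>

lemma extend:
  assumes t: "0 \<le> t" "t < 1"
    and w: "w \<in> set (\<Lambda> (0, n))" "\<And>j. Suc j = n \<Longrightarrow> v 0 j < w"
    and b: "b \<in> set_pmf (mode_pmf t (\<Lambda> (0, 0)) (prev_row \<Lambda> m n) (hs n) w)"
  obtains \<Lambda>' where "grid N m (Suc n) \<Lambda>'" "\<And>i j. i \<le> m \<Longrightarrow> j \<le> n \<Longrightarrow> \<Lambda>' (i, j) = \<Lambda> (i, j)"
    "\<Lambda>' (0, Suc n) = advance w (\<Lambda> (0, n))" "vpos \<Lambda>' 0 n = w"
    "vpos \<Lambda>' m n = snd (pass b w (hs n))" "hrow \<Lambda>' m (Suc n) = fst (pass b w (hs n))"
    "prev_row \<Lambda>' m (Suc n) = Some (snd (pass b w (hs n)), kind_of b w (hs n))"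
proof -
  define x where "x i = snd (pass b w (map (\<lambda>i. h i n) [0..<i]))" for i
  define g where "g i = (if b \<and> h i n = x i then h i n + 1 else h i n)" for i
  have x0: "x 0 = w" by (simp add: x_def)
  have xS: "x (Suc i) = (if b \<and> h i n = x i then x i + 1 else x i)" for i
    by (simp add: x_def pass_append)
  have pass: "pass b w (hs n) = (map g [0..<m], x m)"
    using pass_eq_rec[of m x b "\<lambda>i. h i n" g] xS by (simp add: g_def x0 hrow_def)
  have xw: "x i = w" if "\<not> b" for i by (induction i) (simp_all add: x0 xS that)
  have stay: "2 \<le> count_list (\<Lambda> (i, n)) w" "h i n = w"
    if "\<not> b" "i < m" "h i n = x i" for i
  proof -
    show hw: "h i n = w" using that xw by simp
    then have "w \<in> set (hs n)" using not_in_hs that by blast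
    then have "push_prob t (\<Lambda> (0, 0)) (prev_row \<Lambda> m n) (hs n) w \<noteq> 1"
      using b that(1) push_prob_bounds[OF t, of "\<Lambda> (0, 0)" "prev_row \<Lambda> m n" "hs n" w]
      by (auto simp: mode_pmf_def set_pmf_iff)
    then show "2 \<le> count_list (\<Lambda> (i, n)) w"
      using count_stay[OF t w that(2) hw] by blast
  qed
  have stay_advance: "w \<in> set (advance w (\<Lambda> (i, n)))" if "\<not> b" "i < m" "h i n = x i" for i
  proof -
    have "w \<in> set (\<Lambda> (i, n))" using h_moves(1)[of i n] stay(2)[OF that] that by simp
    then have "count_list (advance w (\<Lambda> (i, n))) w \<noteq> 0"
      using count_list_advance[of w "\<Lambda> (i, n)" w] stay(1)[OF that] by simp
    then show ?thesis using count_list_0_iff by metis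
  qed
  have x_in: "x i \<in> set (\<Lambda> (i, n))" if "i \<le> m" for i
    using that
  proof (induction i)
    case 0
    then show ?case using w x0 by simp
  next
    case (Suc i)
    then have i: "i < m" "x i \<in> set (\<Lambda> (i, n))" by auto
    have L: "h i n \<in> set (\<Lambda> (i, n))" "\<Lambda> (Suc i, n) = advance (h i n) (\<Lambda> (i, n))"
      using h_moves[of i n] i by auto
    consider "h i n \<noteq> x i" | "b" "h i n = x i" | "\<not> b" "h i n = x i" by blast
    then show ?case
    proof cases
      case 1
      then show ?thesis using L i in_set_advance[OF L(1) i(2)] by (simp add: xS)
    next
      case 2
      then show ?thesis using L in_set_advance_target by (simp add: xS)
    next
      case 3
      then show ?thesis using L stay_advance[OF 3(1) i(1) 3(2)] stay(2)[OF 3(1) i(1) 3(2)]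
        by (simp add: xS)
    qed
  qed
  define L where "L i = advance (x i) (\<Lambda> (i, n))" for i
  have L_Sig: "L i \<in> Sig N" if "i \<le> m" for i
    unfolding L_def by (rule advance_in_Sig) (use in_Sig x_in that in auto)
  have L_step: "g i \<in> set (L i) \<and> L (Suc i) = advance (g i) (L i)" if "i < m" for i
  proof -
    have M: "h i n \<in> set (\<Lambda> (i, n))" "\<Lambda> (Suc i, n) = advance (h i n) (\<Lambda> (i, n))" "x i \<in> set (\<Lambda> (i, n))"
      using h_moves[of i n] that x_in by auto
    consider "h i n \<noteq> x i" | "b" "h i n = x i" | "\<not> b" "h i n = x i" by blast
    then show ?thesis
    proof cases
      case 1
      then show ?thesis using M in_set_advance[OF M(3,1)] advance_commute[OF M(1,3)]
        by (simp add: L_def g_def xS)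
    next
      case 2
      then show ?thesis using M in_set_advance_target by (simp add: L_def g_def xS)
    next
      case 3
      then show ?thesis using M stay_advance[OF 3(1) that 3(2)] stay(2)[OF 3(1) that 3(2)]
        by (simp add: L_def g_def xS)
    qed
  qed
  have above: "v i n' < x i" if "n = Suc n'" "i \<le> m" for i n'
  proof (cases b)
    case True
    from that(2) show ?thesis
    proof (induction i)
      case 0
      then show ?case using w(2)[of n'] that x0 by simp
    next
      case (Suc i)
      then show ?case using step[of i n'] that(1) True by (auto simp: xS split: if_splits)
    qed
  next
    case False
    have "w \<in> set (hs n)" using b False by (auto simp: mode_pmf_def split: if_splits)
    then have "push_prob t (\<Lambda> (0, 0)) (prev_row \<Lambda> m n) (hs n) w \<noteq> 1"
      using b False push_prob_bounds[OF t, of "\<Lambda> (0, 0)" "prev_row \<Lambda> m n" "hs n" w]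
      by (auto simp: mode_pmf_def set_pmf_iff)
    then have "v m n' < w - 1 \<or> kind_of (mode n') (v 0 n') (hs n') \<noteq> Push"
      using that by (auto simp: prev_row_def split: if_splits)
    moreover have "v m n' = v 0 n'" if "kind_of (mode n') (v 0 n') (hs n') \<noteq> Push"
      using no_collision[of n' m] v_const[of 0 m n'] \<open>n = Suc n'\<close> that
      by (auto simp: kind_of_def split: if_splits)
    ultimately have "v m n' < w" using w(2)[of n'] that by auto
    then show ?thesis using xw[OF False] v_mono[of i m n'] that by simp
  qed
  define \<Lambda>' where "\<Lambda>' p = (if fst p \<le> m \<and> snd p = Suc n then L (fst p) else \<Lambda> p)" for p
  have old: "\<Lambda>' (i, j) = \<Lambda> (i, j)" if "j \<le> n" for i j using that by (simp add: \<Lambda>'_def)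
  have new: "\<Lambda>' (i, Suc n) = L i" if "i \<le> m" for i using that by (simp add: \<Lambda>'_def)
  define hf where "hf i j = (if j = Suc n then g i else h i j)" for i j
  define vf where "vf i j = (if j = n then x i else v i j)" for i j
  have H: "moves (hf i j) (\<Lambda>' (i, j)) (\<Lambda>' (Suc i, j))" if "i < m" "j \<le> Suc n" for i j
  proof (cases "j = Suc n")
    case True
    then show ?thesis using L_step[of i] that moves_advance[of "g i" "L i"] by (simp add: hf_def new)
  next
    case False
    then show ?thesis using h_moves[of i j] that moves_advance[of "h i j" "\<Lambda> (i, j)"] by (simp add: hf_def old)
  qed
  have V: "moves (vf i j) (\<Lambda>' (i, j)) (\<Lambda>' (i, Suc j))" if "i \<le> m" "j < Suc n" for i j
  proof (cases "j = n")
    case True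
    then show ?thesis using x_in[of i] that moves_advance[of "x i" "\<Lambda> (i, n)"] by (simp add: vf_def new old L_def)
  next
    case False
    then show ?thesis using v_moves[of i j] that moves_advance[of "v i j" "\<Lambda> (i, j)"] by (simp add: vf_def old)
  qed
  have "sorted_wrt (<) (map g [0..<m])"
    using sorted_pass[OF sorted_hs[of n], of b w] pass by simp
  then have g_less: "g i < g (Suc i)" if "Suc i < m" for i
    using that by (auto simp: sorted_wrt_iff_nth_less)
  have grid': "grid N m (Suc n) \<Lambda>'"
  proof (rule admissibleI[OF _ H V])
    have "\<Lambda> \<in> ({0..m} \<times> {0..n}) \<rightarrow>\<^sub>E Sig N" using adm unfolding admissible_def by (elim conjE)
    then have "\<Lambda> p = undefined" if "p \<notin> {0..m} \<times> {0..n}" for p by (rule PiE_arb[OF _ that])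
    then have "\<Lambda>' p = undefined" if "p \<notin> {0..m} \<times> {0..Suc n}" for p
      using that by (cases p) (auto simp: \<Lambda>'_def)
    then show "\<Lambda>' \<in> ({0..m} \<times> {0..Suc n}) \<rightarrow>\<^sub>E Sig N"
      using L_Sig in_Sig by (intro PiE_I) (auto simp: \<Lambda>'_def le_Suc_eq)
  next
    show "hf i j < hf (Suc i) j" if "Suc i < m" "j \<le> Suc n" for i j
      using that g_less h_less[of i "Suc i" j] by (simp add: hf_def)
    show "vf i j < vf i (Suc j)" if "i \<le> m" "Suc j < Suc n" for i j
      using that above[of j i] v_less[of j "Suc j" i] by (auto simp: vf_def)
    show "hf i (Suc j) = vf (Suc i) j \<and> vf (Suc i) j \<in> {hf i j, hf i j + 1}"
      if "i < m" "j < Suc n" "hf i j = vf i j" for i j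
      using that collision[of i j] by (auto simp: vf_def hf_def g_def xS)
  qed
  have h': "hpos \<Lambda>' i j = hf i j" if "i < m" "j \<le> Suc n" for i j using hpos_eq[where \<Lambda> = \<Lambda>', OF H[OF that]] .
  have v': "vpos \<Lambda>' i j = vf i j" if "i \<le> m" "j < Suc n" for i j using vpos_eq[where \<Lambda> = \<Lambda>', OF V[OF that]] .
  have hr: "hrow \<Lambda>' m (Suc n) = map g [0..<m]" "hrow \<Lambda>' m n = hs n"
    by (auto simp: hrow_def h' hf_def)
  have "row_mode \<Lambda>' m n \<longleftrightarrow> (w \<in> set (hs n) \<longrightarrow> x m \<noteq> w)"
    by (simp add: row_mode_def hr v' vf_def x0)
  then have "kind_of (row_mode \<Lambda>' m n) w (hs n) = kind_of b w (hs n)"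
    using less_snd_pass_True[of w "hs n"] pass xw by (cases b) (auto simp: kind_of_def)
  then have "prev_row \<Lambda>' m (Suc n) = Some (x m, kind_of b w (hs n))"
    by (simp add: prev_row_def v' vf_def hr x0)
  then show ?thesis using that[OF grid'] old new[of 0] pass hr v'[of 0 n] v'[of m n]
    by (simp add: x0 L_def vf_def)
qed

end

lemma extend_chain:
  assumes t: "0 \<le> t" "t < 1" and "grid N m n \<Lambda>" "movable (\<Lambda> (0, n)) vs" "sorted_wrt (<) vs"
    "\<And>j. Suc j = n \<Longrightarrow> vs \<noteq> [] \<Longrightarrow> vpos \<Lambda> 0 j < hd vs"
    "(x, us) \<in> set_pmf (chain t (\<Lambda> (0, 0)) (prev_row \<Lambda> m n) (hrow \<Lambda> m n) vs)"
  shows "\<exists>\<Lambda>'. grid N m (n + length vs) \<Lambda>' \<and> (\<forall>i\<le>m. \<forall>j\<le>n. \<Lambda>' (i, j) = \<Lambda> (i, j)) \<and>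
    \<Lambda>' (0, n + length vs) = fold advance vs (\<Lambda> (0, n)) \<and> hrow \<Lambda>' m (n + length vs) = x \<and>
    map (vpos \<Lambda>' m) [n..<n + length vs] = us"
  using assms(3-)
proof (induction vs arbitrary: n \<Lambda> us)
  case Nil
  then show ?case by (intro exI[of _ \<Lambda>]) auto
next
  case (Cons w vs)
  interpret grid N m n \<Lambda> by fact
  obtain b us' where b: "b \<in> set_pmf (mode_pmf t (\<Lambda> (0, 0)) (prev_row \<Lambda> m n) (hs n) w)"
    and us: "us = snd (pass b w (hs n)) # us'"
    and x: "(x, us') \<in> set_pmf (chain t (\<Lambda> (0, 0)) (Some (snd (pass b w (hs n)), kind_of b w (hs n)))
      (fst (pass b w (hs n))) vs)"
    using Cons.prems(5) by auto
  obtain \<Lambda>1 where L1: "grid N m (Suc n) \<Lambda>1" "\<And>i j. i \<le> m \<Longrightarrow> j \<le> n \<Longrightarrow> \<Lambda>1 (i, j) = \<Lambda> (i, j)"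
    "\<Lambda>1 (0, Suc n) = advance w (\<Lambda> (0, n))" "vpos \<Lambda>1 0 n = w"
    "vpos \<Lambda>1 m n = snd (pass b w (hs n))" "hrow \<Lambda>1 m (Suc n) = fst (pass b w (hs n))"
    "prev_row \<Lambda>1 m (Suc n) = Some (snd (pass b w (hs n)), kind_of b w (hs n))"
    using extend[OF t _ _ b] Cons.prems(2,4) by (auto simp del: split_paired_All)
  have "\<exists>\<Lambda>'. grid N m (Suc n + length vs) \<Lambda>' \<and> (\<forall>i\<le>m. \<forall>j\<le>Suc n. \<Lambda>' (i, j) = \<Lambda>1 (i, j)) \<and>
    \<Lambda>' (0, Suc n + length vs) = fold advance vs (\<Lambda>1 (0, Suc n)) \<and> hrow \<Lambda>' m (Suc n + length vs) = x \<and>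
    map (vpos \<Lambda>' m) [Suc n..<Suc n + length vs] = us'"
  proof (rule Cons.IH[OF L1(1)])
    show "movable (\<Lambda>1 (0, Suc n)) vs" using Cons.prems(2) L1(3) by simp
    show "sorted_wrt (<) vs" using Cons.prems(3) by simp
    show "vpos \<Lambda>1 0 j < hd vs" if "Suc j = Suc n" "vs \<noteq> []" for j
      using that L1(4) Cons.prems(3) by (cases vs) auto
    show "(x, us') \<in> set_pmf (chain t (\<Lambda>1 (0, 0)) (prev_row \<Lambda>1 m (Suc n)) (hrow \<Lambda>1 m (Suc n)) vs)"
      using x L1 by simp
  qed
  then obtain \<Lambda>' where L': "grid N m (Suc n + length vs) \<Lambda>'" "\<forall>i\<le>m. \<forall>j\<le>Suc n. \<Lambda>' (i, j) = \<Lambda>1 (i, j)"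
    "\<Lambda>' (0, Suc n + length vs) = fold advance vs (\<Lambda>1 (0, Suc n))" "hrow \<Lambda>' m (Suc n + length vs) = x"
    "map (vpos \<Lambda>' m) [Suc n..<Suc n + length vs] = us'" by blast
  have "vpos \<Lambda>' m n = vpos \<Lambda>1 m n" using L'(2) by (simp add: vpos_def)
  then have "map (vpos \<Lambda>' m) [n..<n + length (w # vs)] = us"
    using L'(5) L1(5) us by (subst upt_conv_Cons) (simp_all del: upt_Suc)
  then show ?case using L' L1 by (intro exI[of _ \<Lambda>']) simp
qed

lemma grid_of_row:
  assumes "lam \<in> Sig N" "movable lam hs0" "sorted_wrt (<) hs0"
  obtains \<Lambda> where "grid N (length hs0) 0 \<Lambda>" "\<Lambda> (0, 0) = lam" "\<Lambda> (length hs0, 0) = fold advance hs0 lam"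
    "hrow \<Lambda> (length hs0) 0 = hs0"
proof -
  define m where "m = length hs0"
  define \<Lambda> :: "nat \<times> nat \<Rightarrow> int list" where "\<Lambda> = restrict (\<lambda>(i, j). fold advance (take i hs0) lam) ({0..m} \<times> {0..0})"
  have mt: "movable lam (take i hs0)" for i
    using assms(2) movable_append[of lam "take i hs0" "drop i hs0"] by simp
  have H: "moves (hs0 ! i) (\<Lambda> (i, j)) (\<Lambda> (Suc i, j))" if "i < m" "j \<le> 0" for i j
  proof -
    have "movable lam (take i hs0 @ [hs0 ! i])" using mt[of "Suc i"] that by (simp add: take_Suc_conv_app_nth m_def)
    then have "hs0 ! i \<in> set (fold advance (take i hs0) lam)" by (simp add: movable_append)
    moreover have "\<Lambda> (i, j) = fold advance (take i hs0) lam" using that by (simp add: \<Lambda>_def)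
    ultimately have "hs0 ! i \<in> set (\<Lambda> (i, j))" by simp
    moreover have "\<Lambda> (Suc i, j) = advance (hs0 ! i) (\<Lambda> (i, j))"
      using that by (simp add: \<Lambda>_def take_Suc_conv_app_nth m_def)
    ultimately show ?thesis by (simp add: moves_advance)
  qed
  have "grid N m 0 \<Lambda>"
  proof (rule admissibleI[of \<Lambda> m 0 N "\<lambda>i j. hs0 ! i" "\<lambda>i j. 0"])
    show "\<Lambda> \<in> {0..m} \<times> {0..0} \<rightarrow>\<^sub>E Sig N"
      unfolding \<Lambda>_def using fold_advance_in_Sig[OF assms(1) mt] by auto
  qed (use H assms(3) in \<open>auto simp: sorted_wrt_iff_nth_less m_def\<close>)
  moreover have "hrow \<Lambda> m 0 = hs0"
    unfolding hrow_def by (rule nth_equalityI) (use hpos_eq[where \<Lambda> = \<Lambda>, OF H] in \<open>auto simp: m_def\<close>)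
  ultimately show ?thesis using that[of \<Lambda>] by (simp add: \<Lambda>_def m_def)
qed

section \<open>The law of the output\<close>

lemma (in grid) boundary:
  shows "movable (\<Lambda> (0, 0)) (hs 0)" "fold advance (hs 0) (\<Lambda> (0, 0)) = \<Lambda> (m, 0)"
    "movable (\<Lambda> (0, n)) (hs n)" "fold advance (hs n) (\<Lambda> (0, n)) = \<Lambda> (m, n)"
    "movable (\<Lambda> (0, 0)) (map (v 0) [0..<n])" "fold advance (map (v 0) [0..<n]) (\<Lambda> (0, 0)) = \<Lambda> (0, n)"
    "movable (\<Lambda> (m, 0)) (map (v m) [0..<n])" "fold advance (map (v m) [0..<n]) (\<Lambda> (m, 0)) = \<Lambda> (m, n)"
    "sorted_wrt (<) (hs 0)" "sorted_wrt (<) (hs n)"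
    "sorted_wrt (<) (map (v 0) [0..<n])" "sorted_wrt (<) (map (v m) [0..<n])"
  using row_fold[of m 0] row_fold[of m n] column_fold[of n 0] column_fold[of n m]
    sorted_hs[of 0] sorted_hs[of n]
  by (auto simp: hrow_def sorted_wrt_iff_nth_less v_less)

lemma grid_of_chain:
  assumes t: "0 \<le> t" "t < 1" and lam: "lam \<in> Sig N"
    and hs0: "movable lam hs0" "sorted_wrt (<) hs0"
    and vs0: "movable lam vs0" "sorted_wrt (<) vs0"
    and x: "(x, us) \<in> set_pmf (chain t lam None hs0 vs0)"
  obtains \<Lambda> where "grid N (length hs0) (length vs0) \<Lambda>" "\<Lambda> (0, 0) = lam"
    "\<Lambda> (length hs0, 0) = fold advance hs0 lam" "\<Lambda> (0, length vs0) = fold advance vs0 lam"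
    "hrow \<Lambda> (length hs0) (length vs0) = x" "map (vpos \<Lambda> (length hs0)) [0..<length vs0] = us"
proof -
  obtain \<Lambda>0 where L0: "grid N (length hs0) 0 \<Lambda>0" "\<Lambda>0 (0, 0) = lam"
    "\<Lambda>0 (length hs0, 0) = fold advance hs0 lam" "hrow \<Lambda>0 (length hs0) 0 = hs0"
    using grid_of_row[OF lam hs0] .
  have "\<exists>\<Lambda>'. grid N (length hs0) (0 + length vs0) \<Lambda>' \<and>
    (\<forall>i\<le>length hs0. \<forall>j\<le>0. \<Lambda>' (i, j) = \<Lambda>0 (i, j)) \<and>
    \<Lambda>' (0, 0 + length vs0) = fold advance vs0 (\<Lambda>0 (0, 0)) \<and> hrow \<Lambda>' (length hs0) (0 + length vs0) = x \<and>
    map (vpos \<Lambda>' (length hs0)) [0..<0 + length vs0] = us"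
    by (rule extend_chain[OF t L0(1)]) (use vs0 x L0 in \<open>auto simp: prev_row_def\<close>)
  then obtain \<Lambda>' where "grid N (length hs0) (length vs0) \<Lambda>'"
    "\<forall>i\<le>length hs0. \<forall>j\<le>0. \<Lambda>' (i, j) = \<Lambda>0 (i, j)"
    "\<Lambda>' (0, length vs0) = fold advance vs0 (\<Lambda>0 (0, 0))" "hrow \<Lambda>' (length hs0) (length vs0) = x"
    "map (vpos \<Lambda>' (length hs0)) [0..<length vs0] = us" by auto
  then show ?thesis using that[of \<Lambda>'] L0 by simp
qed

definition output_pmf :: "real \<Rightarrow> int list \<Rightarrow> int list \<Rightarrow> int list \<Rightarrow> int list pmf" where
  "output_pmf t lam hs0 vs0 =
     map_pmf (\<lambda>(x, us). fold advance x (fold advance vs0 lam)) (chain t lam None hs0 vs0)"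

text \<open>The top row of a diagram is the increasing list of moves from \<open>\<mu>\<close> to \<open>\<rho>\<close> and its right column
  the one from \<open>\<nu>\<close> to \<open>\<rho>\<close>. So at most one outcome of the chain yields \<open>\<rho>\<close>, and its
  probability is the weight of any admissible \<open>\<Lambda>\<close> with these corners; in particular, it
  does not matter which one is chosen in the definition of \<open>U\<close>.\<close>

lemma U_eq_pmf:
  assumes t: "0 \<le> t" "t < 1" and lam: "lam \<in> Sig N"
    and hs0: "movable lam hs0" "sorted_wrt (<) hs0"
    and vs0: "movable lam vs0" "sorted_wrt (<) vs0"
  shows "U t N (fold advance vs0 lam) \<rho> lam (fold advance hs0 lam) = pmf (output_pmf t lam hs0 vs0) \<rho>"
proof -
  define m where "m = length hs0"
  define n where "n = length vs0"
  define \<mu> where "\<mu> = fold advance vs0 lam"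
  define \<nu> where "\<nu> = fold advance hs0 lam"
  define C where "C = chain t lam None hs0 vs0"
  let ?f = "\<lambda>(x, us). fold advance x \<mu>"
  have \<mu>: "\<mu> \<in> Sig N" and \<nu>: "\<nu> \<in> Sig N"
    unfolding \<mu>_def \<nu>_def using fold_advance_in_Sig lam hs0 vs0 by auto
  have mn: "nat (sum_list \<nu> - sum_list lam) = m" "nat (sum_list \<mu> - sum_list lam) = n"
    using sum_list_fold_advance[OF hs0(1)] sum_list_fold_advance[OF vs0(1)] by (simp_all add: m_def n_def \<mu>_def \<nu>_def)
  have from_chain: "\<exists>\<Lambda>. admissible N m n \<mu> (?f p) lam \<nu> \<Lambda> \<and> p = (hrow \<Lambda> m n, map (vpos \<Lambda> m) [0..<n])"
    if pC: "p \<in> set_pmf C" for p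
  proof -
    obtain x us where p: "p = (x, us)" by (cases p)
    obtain \<Lambda> where L: "grid N m n \<Lambda>" "\<Lambda> (0, 0) = lam"
      "\<Lambda> (m, 0) = \<nu>" "\<Lambda> (0, n) = \<mu>" "hrow \<Lambda> m n = x" "map (vpos \<Lambda> m) [0..<n] = us"
      using grid_of_chain[OF t lam hs0 vs0, of x us] pC unfolding p C_def m_def n_def \<mu>_def \<nu>_def by blast
    then have "?f p = \<Lambda> (m, n)" using grid.boundary(4)[OF L(1)] p by simp
    then have "admissible N m n \<mu> (?f p) lam \<nu> \<Lambda>" using L(1-4) unfolding grid_def by simp
    then show ?thesis using p L(5,6) by blast
  qed
  have to_grid: "grid N m n \<Lambda> \<and> \<Lambda> (0, 0) = lam \<and> \<Lambda> (m, 0) = \<nu> \<and> \<Lambda> (0, n) = \<mu> \<and> \<Lambda> (m, n) = \<rho>"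
    if "admissible N m n \<mu> \<rho> lam \<nu> \<Lambda>" for \<Lambda> \<rho>
  proof -
    have "\<Lambda> (0, 0) = lam" "\<Lambda> (m, 0) = \<nu>" "\<Lambda> (0, n) = \<mu>" "\<Lambda> (m, n) = \<rho>"
      using that unfolding admissible_def by simp_all
    then show ?thesis using that unfolding grid_def by simp
  qed
  have P: "pmf (output_pmf t lam hs0 vs0) \<rho> = measure C (?f -` {\<rho>} \<inter> set_pmf C)"
    by (simp add: output_pmf_def pmf_map C_def \<mu>_def measure_Int_set_pmf)
  show ?thesis
  proof (cases "\<exists>\<Lambda>. admissible N m n \<mu> \<rho> lam \<nu> \<Lambda>")
    case True
    define \<Lambda> where "\<Lambda> = (SOME \<Lambda>. admissible N m n \<mu> \<rho> lam \<nu> \<Lambda>)"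
    have adm_L: "admissible N m n \<mu> \<rho> lam \<nu> \<Lambda>" unfolding \<Lambda>_def using True by (rule someI_ex)
    then interpret grid N m n \<Lambda> using to_grid by blast
    have corners: "\<Lambda> (0, 0) = lam" "\<Lambda> (m, 0) = \<nu>" "\<Lambda> (0, n) = \<mu>" "\<Lambda> (m, n) = \<rho>"
      using to_grid[OF adm_L] by auto
    note bd = boundary[unfolded corners]
    have "hs 0 = hs0"
      by (rule movable_unique[of lam]) (use bd hs0 in \<open>simp_all add: \<nu>_def\<close>)
    moreover have "map (v 0) [0..<n] = vs0"
      by (rule movable_unique[of lam]) (use bd vs0 in \<open>simp_all add: \<mu>_def\<close>)
    ultimately have W: "(\<Prod>i<m. \<Prod>j<n. box_weight t \<Lambda> i j) = pmf C (hs n, map (v m) [0..<n])"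
      using diagram_weight[OF t] by (simp add: C_def corners)
    have "p = (hs n, map (v m) [0..<n])" if p: "p \<in> set_pmf C" "?f p = \<rho>" for p
    proof -
      obtain \<Lambda>2 where L2: "admissible N m n \<mu> \<rho> lam \<nu> \<Lambda>2"
        "p = (hrow \<Lambda>2 m n, map (vpos \<Lambda>2 m) [0..<n])"
        using from_chain[OF p(1)] p(2) by auto
      have g2: "grid N m n \<Lambda>2" "\<Lambda>2 (0, 0) = lam" "\<Lambda>2 (m, 0) = \<nu>" "\<Lambda>2 (0, n) = \<mu>" "\<Lambda>2 (m, n) = \<rho>"
        using to_grid[OF L2(1)] by auto
      note bd2 = grid.boundary[OF g2(1), unfolded g2]
      have "hrow \<Lambda>2 m n = hs n"
        by (rule movable_unique[of \<mu>]) (use bd bd2 in simp_all)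
      moreover have "map (vpos \<Lambda>2 m) [0..<n] = map (v m) [0..<n]"
        by (rule movable_unique[of \<nu>]) (use bd bd2 in simp_all)
      ultimately show ?thesis using L2(2) by simp
    qed
    moreover have "?f (hs n, map (v m) [0..<n]) = \<rho>" using bd(4) by simp
    ultimately have "?f -` {\<rho>} \<inter> set_pmf C = {(hs n, map (v m) [0..<n])} \<inter> set_pmf C" by blast
    then have "pmf (output_pmf t lam hs0 vs0) \<rho> = pmf C (hs n, map (v m) [0..<n])"
      unfolding P by (simp only: measure_Int_set_pmf measure_pmf_single)
    moreover have "interlaces lam \<mu>" "interlaces lam \<nu>" "interlaces \<mu> \<rho>" "interlaces \<nu> \<rho>"
      using interlaces_fold_advance[OF lam vs0] interlaces_fold_advance[OF lam hs0]
        interlaces_fold_advance[OF \<mu> bd(3,10)] interlaces_fold_advance[OF \<nu> bd(7,12)] bd(4,8)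
      by (simp_all add: \<mu>_def \<nu>_def)
    moreover have "sum_list \<nu> - sum_list lam = sum_list \<rho> - sum_list \<mu>"
      using sum_list_fold_advance[OF bd(1)] sum_list_fold_advance[OF bd(3)] bd(2,4) by simp
    ultimately show ?thesis
      using True W unfolding U_def Let_def mn \<Lambda>_def[symmetric] \<mu>_def[symmetric] \<nu>_def[symmetric] by simp
  next
    case False
    then have "?f -` {\<rho>} \<inter> set_pmf C = {}" using from_chain by force
    then have "pmf (output_pmf t lam hs0 vs0) \<rho> = 0" unfolding P by simp
    moreover have "U t N \<mu> \<rho> lam \<nu> = 0"
      unfolding U_def Let_def mn by (rule if_not_P) (use False in blast)
    ultimately show ?thesis by (simp add: \<mu>_def \<nu>_def)
  qed
qed

text \<open>Outcomes are realised by diagrams, whose top rows are sequences of possible moves.\<close>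

lemma output_pmf_support:
  assumes t: "0 \<le> t" "t < 1" and lam: "lam \<in> Sig N"
    and hs0: "movable lam hs0" "sorted_wrt (<) hs0"
    and vs0: "movable lam vs0" "sorted_wrt (<) vs0"
    and x: "(x, us) \<in> set_pmf (chain t lam None hs0 vs0)"
  shows "movable (fold advance vs0 lam) x" "fold advance x (fold advance vs0 lam) \<in> Sig N"
proof -
  obtain \<Lambda> where L: "grid N (length hs0) (length vs0) \<Lambda>" "\<Lambda> (0, length vs0) = fold advance vs0 lam"
    "hrow \<Lambda> (length hs0) (length vs0) = x"
    using grid_of_chain[OF t lam hs0 vs0 x] by blast
  show "movable (fold advance vs0 lam) x" using grid.boundary(3)[OF L(1)] L by simp
  then show "fold advance x (fold advance vs0 lam) \<in> Sig N"
    using fold_advance_in_Sig[OF fold_advance_in_Sig[OF lam vs0(1)]] by blast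
qed

lemma point_measure_pmf:
  assumes "\<And>x. x \<in> S \<Longrightarrow> f x = ennreal (pmf P x)" "set_pmf P \<subseteq> S" "X \<subseteq> S"
  shows "emeasure (point_measure S f) X = emeasure P X"
proof -
  have "emeasure (point_measure S f) X = (\<integral>\<^sup>+ x. f x * indicator X x \<partial>count_space S)"
    unfolding point_measure_def using assms(3) by (subst emeasure_density) auto
  also have "\<dots> = (\<integral>\<^sup>+ x. ennreal (pmf P x) * indicator X x \<partial>count_space S)"
    by (rule nn_integral_cong) (simp add: assms(1))
  also have "\<dots> = (\<integral>\<^sup>+ x. pmf P x \<partial>count_space X)"
    using assms(3) by (subst (2) nn_integral_count_space_indicator)
      (auto simp: nn_integral_count_space_indicator indicator_def intro!: nn_integral_cong)
  also have "\<dots> = emeasure P X" by (rule nn_integral_pmf)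
  finally show ?thesis .
qed

text \<open>The family up to \<open>k\<close> sees the moves from \<open>\<mu>\<close> to \<open>\<rho>\<close> only at places below \<open>k\<close>. The restriction to
  families that are \<open>undefined\<close> above \<open>k\<close> matches the underlying space of \<open>conj_law\<close>.\<close>

lemma conj_law_HL_RSK:
  assumes t: "0 \<le> t" "t < 1" and lam: "lam \<in> Sig N"
    and hs0: "movable lam hs0" "sorted_wrt (<) hs0"
    and vs0: "movable lam vs0" "sorted_wrt (<) vs0"
  shows "conj_law k (HL_RSK t N lam (fold advance vs0 lam) (fold advance hs0 lam)) =
    restrict_space (measure_pmf (map_pmf
      (\<lambda>l. \<lambda>a\<in>{..k}. conj_part (fold advance vs0 lam) a + count_list l (a - 1))
      (map_pmf (\<lambda>(x, us). filter (\<lambda>a. a < k) x) (chain t lam None hs0 vs0)))) ({..k} \<rightarrow>\<^sub>E UNIV)"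
    (is "_ = restrict_space (measure_pmf ?Q) ?E")
proof (rule measure_eqI)
  let ?P = "output_pmf t lam hs0 vs0"
  let ?g = "\<lambda>\<kappa>. restrict (conj_part \<kappa>) {..k}"
  let ?M = "HL_RSK t N lam (fold advance vs0 lam) (fold advance hs0 lam)"
  show "sets (conj_law k ?M) = sets (restrict_space (measure_pmf ?Q) ?E)"
    by (auto simp: conj_law_def sets_restrict_space)
  have supp: "set_pmf ?P \<subseteq> Sig N"
    using output_pmf_support(2)[OF assms] by (auto simp: output_pmf_def)
  have Q: "map_pmf ?g ?P = ?Q"
    unfolding output_pmf_def map_pmf_comp
  proof (rule map_pmf_cong[OF refl], clarify)
    fix x us assume "(x, us) \<in> set_pmf (chain t lam None hs0 vs0)"
    from conj_part_fold_advance[OF output_pmf_support(1)[OF assms this]]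
    show "restrict (conj_part (fold advance x (fold advance vs0 lam))) {..k} =
      (\<lambda>a\<in>{..k}. conj_part (fold advance vs0 lam) a + count_list (filter (\<lambda>a. a < k) x) (a - 1))"
      by (auto simp: fun_eq_iff restrict_def count_mset[symmetric])
  qed
  fix A assume "A \<in> sets (conj_law k ?M)"
  then have A: "A \<subseteq> ?E" by (simp add: conj_law_def)
  have g: "?g \<in> measurable ?M (count_space ?E)"
    by (auto simp: HL_RSK_def measurable_def sets_point_measure space_point_measure)
  have "space ?M = Sig N" by (simp add: HL_RSK_def space_point_measure)
  moreover have "emeasure (conj_law k ?M) A = emeasure ?M (?g -` A \<inter> space ?M)"
    unfolding conj_law_def by (rule emeasure_distr[OF g]) (use A in simp)
  ultimately have "emeasure (conj_law k ?M) A = emeasure ?M (?g -` A \<inter> Sig N)" by simp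
  also have "\<dots> = emeasure ?P (?g -` A \<inter> Sig N)"
    unfolding HL_RSK_def by (rule point_measure_pmf) (auto simp: U_eq_pmf[OF assms] intro: subsetD[OF supp])
  also have "\<dots> = emeasure ?P (?g -` A)"
    using supp by (intro emeasure_eq_AE) (auto simp: AE_measure_pmf_iff)
  also have "\<dots> = emeasure (map_pmf ?g ?P) A" by simp
  also have "\<dots> = emeasure (restrict_space (measure_pmf ?Q) ?E) A"
    unfolding Q using A by (subst emeasure_restrict_space) auto
  finally show "emeasure (conj_law k ?M) A = emeasure (restrict_space (measure_pmf ?Q) ?E) A" .
qed

lemma strip_filter_cong:
  assumes "sorted_wrt (<) ks1" "set ks1 = {a. conj_part \<kappa>1 (a + 1) \<noteq> conj_part \<kappa>1' (a + 1)}"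
    "sorted_wrt (<) ks2" "set ks2 = {a. conj_part \<kappa>2 (a + 1) \<noteq> conj_part \<kappa>2' (a + 1)}"
    "\<forall>a\<le>k. conj_part \<kappa>1 a = conj_part \<kappa>2 a" "\<forall>a\<le>k. conj_part \<kappa>1' a = conj_part \<kappa>2' a"
  shows "filter (\<lambda>a. a < (k::int)) ks1 = filter (\<lambda>a. a < k) ks2"
proof (rule strict_sorted_equal[symmetric])
  show "sorted_wrt (<) (filter (\<lambda>a. a < k) ks1)" "sorted_wrt (<) (filter (\<lambda>a. a < k) ks2)"
    using assms by (auto intro: sorted_wrt_filter)
  show "set (filter (\<lambda>a. a < k) ks2) = set (filter (\<lambda>a. a < k) ks1)"
    unfolding set_filter assms(2,4) using assms(5,6) by auto
qed

theorem proposition3p6: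
  fixes t :: real and N :: nat and k :: int
    and lam1 mu1 nu1 lam2 mu2 nu2 :: "int list"
  assumes "0 \<le> t" "t < 1" "1 \<le> N"
    and "lam1 \<in> Sig N" "mu1 \<in> Sig N" "nu1 \<in> Sig N" "lam1 \<prec> mu1" "lam1 \<prec> nu1"
    and "lam2 \<in> Sig N" "mu2 \<in> Sig N" "nu2 \<in> Sig N" "lam2 \<prec> mu2" "lam2 \<prec> nu2"
    and "\<forall>a\<le>k. conj_part lam1 a = conj_part lam2 a"
    and "\<forall>a\<le>k. conj_part mu1 a = conj_part mu2 a"
    and "\<forall>a\<le>k. conj_part nu1 a = conj_part nu2 a"
  shows "conj_law k (HL_RSK t N lam1 mu1 nu1) = conj_law k (HL_RSK t N lam2 mu2 nu2)"
proof -
  obtain vs1 where vs1: "sorted_wrt (<) vs1" "movable lam1 vs1" "fold advance vs1 lam1 = mu1"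
    "set vs1 = {a. conj_part lam1 (a + 1) \<noteq> conj_part mu1 (a + 1)}"
    using interlaces_ex_movable assms(4,5,7) .
  obtain hs1 where hs1: "sorted_wrt (<) hs1" "movable lam1 hs1" "fold advance hs1 lam1 = nu1"
    "set hs1 = {a. conj_part lam1 (a + 1) \<noteq> conj_part nu1 (a + 1)}"
    using interlaces_ex_movable assms(4,6,8) .
  obtain vs2 where vs2: "sorted_wrt (<) vs2" "movable lam2 vs2" "fold advance vs2 lam2 = mu2"
    "set vs2 = {a. conj_part lam2 (a + 1) \<noteq> conj_part mu2 (a + 1)}"
    using interlaces_ex_movable assms(9,10,12) .
  obtain hs2 where hs2: "sorted_wrt (<) hs2" "movable lam2 hs2" "fold advance hs2 lam2 = nu2"
    "set hs2 = {a. conj_part lam2 (a + 1) \<noteq> conj_part nu2 (a + 1)}"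
    using interlaces_ex_movable assms(9,11,13) .
  have count: "\<forall>a<k. count_list lam1 a = count_list lam2 a"
    using count_list_conj_part[of lam1] count_list_conj_part[of lam2] assms(14)
    by (metis add_right_cancel less_imp_le zless_imp_add1_zle)
  have low_v: "filter (\<lambda>a. a < k) vs1 = filter (\<lambda>a. a < k) vs2"
    by (rule strip_filter_cong[OF vs1(1,4) vs2(1,4) assms(14,15)])
  have low_h: "filter (\<lambda>a. a < k) hs1 = filter (\<lambda>a. a < k) hs2"
    by (rule strip_filter_cong[OF hs1(1,4) hs2(1,4) assms(14,16)])
  let ?low = "filter (\<lambda>a. a < k)" and ?high = "filter (\<lambda>a. k \<le> a)"
  have split: "?low vs1 @ ?high vs1 = vs1" "?low vs1 @ ?high vs2 = vs2"
    using sorted_filter_split[OF vs1(1), of k] sorted_filter_split[OF vs2(1), of k] low_v by simp_all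
  have "map_pmf (\<lambda>(x, us). ?low x) (chain t lam1 None hs1 (?low vs1 @ ?high vs1)) =
      map_pmf (\<lambda>(x, us). ?low x) (chain t lam2 None hs2 (?low vs1 @ ?high vs2))"
    by (rule filter_chain_cong[OF count _ _ _ hs1(1) hs2(1) low_h]) auto
  moreover have "(\<lambda>l. \<lambda>a\<in>{..k}. conj_part mu1 a + count_list l (a - 1)) =
      (\<lambda>l. \<lambda>a\<in>{..k}. conj_part mu2 a + count_list l (a - 1))"
    using assms(15) by (auto simp: fun_eq_iff restrict_def)
  ultimately show ?thesis
    unfolding split
    using conj_law_HL_RSK[OF assms(1,2,4) hs1(2,1) vs1(2,1), of k]
      conj_law_HL_RSK[OF assms(1,2,9) hs2(2,1) vs2(2,1), of k]
    by (simp only: vs1(3) vs2(3) hs1(3) hs2(3))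
qed

end
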